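(* Let $N\ge 2$, let $W_1,\ldots,W_N$ be invertible bounded linear operators on $\mathcal H$, and let $r_1,\ldots,r_N\in\mathbb N$ with $0<r_1<\cdots<r_N$. Let $\tilde U$ be a unitary operator on $\mathcal H$ such that for each $k\in\mathbb N$ there exists $N_k\in\mathbb N$ with $\tilde U^n(L_k)\perp L_k$ for all $n\ge N_k$. Let $\mathcal B$ be any one of the spaces $B_0(\mathcal H)$, $B_1(\mathcal H)$, $B_2(\mathcal H)$. Then $T_{\tilde U,W_1}^{r_1},\ldots,T_{\tilde U,W_N}^{r_N}$ satisfy the d-hypercyclicity criterion on $\mathcal B$ if and only if $W_1^{r_1},\ldots,W_N^{r_N}$ satisfy the d-hypercyclicity criterion on $\mathcal H$. Hence $W_1^{r_1},\ldots,W_N^{r_N}$ satisfy the d-hypercyclicity criterion on $\mathcal H$ if and only if $T_{U,W_1}^{r_1},\ldots,T_{U,W_N}^{r_N}$ satisfy the d-hypercyclicity criterion on $\mathcal B$ for every unitary operator $U$ on $\mathcal H$.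
   Context: $\mathcal H$ is a separable Hilbert space with an orthonormal basis $\{e_j\}_{j\in\mathbb N}$, and $L_k:=\mathrm{span}\{e_1,\ldots,e_k\}$. $B(\mathcal H)$ is the set of bounded linear operators on $\mathcal H$; $B_0(\mathcal H)$, $B_1(\mathcal H)$, $B_2(\mathcal H)$ are the spaces of compact, trace class, and Hilbert–Schmidt operators on $\mathcal H$, equipped with the operator norm, trace norm, and Hilbert–Schmidt norm respectively. For $U,W\in B(\mathcal H)$, $T_{U,W}(F):=WFU$; it maps each of these three spaces into itself. Bounded linear operators $T_1,\ldots,T_N$ on a Banach space $\mathcal X$ satisfy the d-hypercyclicity criterion if there exist a strictly increasing sequence $\{n_k\}_{k}\subseteq\mathbb N$, dense subsets $X_0,X_1,\ldots,X_N$ of $\mathcal X$, and mappings $V_{l,k}:X_l\to\mathcal X$ ($1\le l\le N$, $k\in\mathbb N$; not assumed linear or continuous) such that, as $k\to\infty$: $T_l^{n_k}\to0$ pointwise on $X_0$ for every $l$; $V_{l,k}\to0$ pointwise on $X_l$ for every $l$; $T_l^{n_k}V_{s,k}\to0$ pointwise on $X_s$ whenever $s\ne l$; and $T_l^{n_k}V_{l,k}\to \mathrm{Id}_{X_l}$ pointwise on $X_l$ for every $l$. *)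

theory Defs
  imports "HOL-Analysis.Analysis"
begin

text \<open>
  Complex Hilbert spaces. The inner product is linear in the first argument; its positive
  definiteness and its agreement with the given norm are both contained in the last axiom.
\<close>

class complex_hilbert = banach +
  fixes scaleC :: "complex \<Rightarrow> 'a \<Rightarrow> 'a"  (infixr "*\<^sub>C" 75)
    and cinner :: "'a \<Rightarrow> 'a \<Rightarrow> complex"
  assumes scaleC_add_right: "c *\<^sub>C (x + y) = c *\<^sub>C x + c *\<^sub>C y"
    and scaleC_add_left: "(c + d) *\<^sub>C x = c *\<^sub>C x + d *\<^sub>C x"
    and scaleC_scaleC: "c *\<^sub>C (d *\<^sub>C x) = (c * d) *\<^sub>C x"
    and scaleR_scaleC: "a *\<^sub>R x = complex_of_real a *\<^sub>C x"
    and cinner_commute: "cinner x y = cnj (cinner y x)"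
    and cinner_add_left: "cinner (x + y) z = cinner x z + cinner y z"
    and cinner_scaleC_left: "cinner (c *\<^sub>C x) y = c * cinner x y"
    and cinner_self: "cinner x x = complex_of_real ((norm x)\<^sup>2)"

global_interpretation complex_vector:
  vector_space "scaleC :: complex \<Rightarrow> 'a \<Rightarrow> 'a::complex_hilbert"
proof
  fix x :: 'a
  show "1 *\<^sub>C x = x"
    using scaleR_scaleC[of 1 x] by simp
qed (simp_all add: scaleC_add_right scaleC_add_left scaleC_scaleC)

abbreviation cspan :: "'a::complex_hilbert set \<Rightarrow> 'a set"
  where "cspan \<equiv> complex_vector.span"

definition orthonormal_basis :: "(nat \<Rightarrow> 'a::complex_hilbert) \<Rightarrow> bool"
  where "orthonormal_basis e \<longleftrightarrow>
    (\<forall>i j. cinner (e i) (e j) = (if i = j then 1 else 0)) \<and> closure (cspan (range e)) = UNIV"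

text \<open>
  The basis is enumerated from \<open>0\<close>, so the span of its first \<open>k\<close> members is
  \<open>span {e 0, ..., e (k - 1)}\<close>.
\<close>

definition initial_span :: "(nat \<Rightarrow> 'a::complex_hilbert) \<Rightarrow> nat \<Rightarrow> 'a set"
  where "initial_span e k = cspan (e ` {..<k})"

text \<open>
  The type of bounded linear functions is that of real-linear ones, hence the explicit condition
  of complex homogeneity. Its norm is the operator norm.
\<close>

definition bounded_ops :: "('a::complex_hilbert \<Rightarrow>\<^sub>L 'a) set"
  where "bounded_ops = {T. \<forall>c x. blinfun_apply T (c *\<^sub>C x) = c *\<^sub>C blinfun_apply T x}"

definition invertible_op :: "('a::complex_hilbert \<Rightarrow>\<^sub>L 'a) \<Rightarrow> bool"
  where "invertible_op T \<longleftrightarrow> T \<in> bounded_ops \<and>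
    (\<exists>S\<in>bounded_ops. S o\<^sub>L T = id_blinfun \<and> T o\<^sub>L S = id_blinfun)"

definition adjoint_op :: "('a::complex_hilbert \<Rightarrow>\<^sub>L 'a) \<Rightarrow> ('a \<Rightarrow>\<^sub>L 'a)"
  where "adjoint_op T = (THE S. S \<in> bounded_ops \<and>
    (\<forall>x y. cinner (blinfun_apply T x) y = cinner x (blinfun_apply S y)))"

definition unitary_op :: "('a::complex_hilbert \<Rightarrow>\<^sub>L 'a) \<Rightarrow> bool"
  where "unitary_op U \<longleftrightarrow> U \<in> bounded_ops \<and>
    adjoint_op U o\<^sub>L U = id_blinfun \<and> U o\<^sub>L adjoint_op U = id_blinfun"

definition positive_op :: "('a::complex_hilbert \<Rightarrow>\<^sub>L 'a) \<Rightarrow> bool"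
  where "positive_op P \<longleftrightarrow> P \<in> bounded_ops \<and>
    (\<forall>x. Im (cinner (blinfun_apply P x) x) = 0 \<and> 0 \<le> Re (cinner (blinfun_apply P x) x))"

text \<open>The absolute value \<open>|T|\<close>, i.e. the positive square root of \<open>T\<^sup>* T\<close>.\<close>

definition abs_op :: "('a::complex_hilbert \<Rightarrow>\<^sub>L 'a) \<Rightarrow> ('a \<Rightarrow>\<^sub>L 'a)"
  where "abs_op T = (THE P. positive_op P \<and> P o\<^sub>L P = adjoint_op T o\<^sub>L T)"

definition compact_ops :: "('a::complex_hilbert \<Rightarrow>\<^sub>L 'a) set"
  where "compact_ops = {T \<in> bounded_ops. compact (closure (blinfun_apply T ` cball 0 1))}"

text \<open>
  Trace class and Hilbert-Schmidt operators, with the trace of \<open>|T|\<close> and of \<open>T\<^sup>* T\<close> computed in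
  the basis \<open>e\<close>. Both norms are meaningful only on the respective set of operators, since
  \<^const>\<open>suminf\<close> is unspecified on divergent series.
\<close>

definition trace_class_ops :: "(nat \<Rightarrow> 'a::complex_hilbert) \<Rightarrow> ('a \<Rightarrow>\<^sub>L 'a) set"
  where "trace_class_ops e =
    {T \<in> bounded_ops. summable (\<lambda>j. Re (cinner (blinfun_apply (abs_op T) (e j)) (e j)))}"

definition trace_norm :: "(nat \<Rightarrow> 'a::complex_hilbert) \<Rightarrow> ('a \<Rightarrow>\<^sub>L 'a) \<Rightarrow> real"
  where "trace_norm e T = (\<Sum>j. Re (cinner (blinfun_apply (abs_op T) (e j)) (e j)))"

definition hilbert_schmidt_ops :: "(nat \<Rightarrow> 'a::complex_hilbert) \<Rightarrow> ('a \<Rightarrow>\<^sub>L 'a) set"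
  where "hilbert_schmidt_ops e =
    {T \<in> bounded_ops. summable (\<lambda>j. (norm (blinfun_apply T (e j)))\<^sup>2)}"

definition hilbert_schmidt_norm :: "(nat \<Rightarrow> 'a::complex_hilbert) \<Rightarrow> ('a \<Rightarrow>\<^sub>L 'a) \<Rightarrow> real"
  where "hilbert_schmidt_norm e T = sqrt (\<Sum>j. (norm (blinfun_apply T (e j)))\<^sup>2)"

text \<open>The map \<open>F \<mapsto> W F U\<close>.\<close>

definition mult_op ::
  "('a::complex_hilbert \<Rightarrow>\<^sub>L 'a) \<Rightarrow> ('a \<Rightarrow>\<^sub>L 'a) \<Rightarrow> ('a \<Rightarrow>\<^sub>L 'a) \<Rightarrow> ('a \<Rightarrow>\<^sub>L 'a)"
  where "mult_op U W F = W o\<^sub>L F o\<^sub>L U"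

text \<open>
  Density and the criterion for a space given by a carrier \<open>X\<close> and a norm \<open>nrm\<close> on it, so that they
  apply to spaces of operators normed differently from their ambient type. The operators
  \<open>T 1, ..., T N\<close> are functions from \<open>X\<close> to \<open>X\<close>; that \<open>X\<close> is a Banach space and that the operators
  are bounded and linear is not part of the condition. The maps \<open>V l k\<close> matter only on \<open>D l\<close>.
\<close>

definition dense_in :: "'b::ab_group_add set \<Rightarrow> ('b \<Rightarrow> real) \<Rightarrow> 'b set \<Rightarrow> bool"
  where "dense_in X nrm D \<longleftrightarrow> D \<subseteq> X \<and> (\<forall>x\<in>X. \<forall>\<epsilon>>0. \<exists>d\<in>D. nrm (x - d) < \<epsilon>)"

definition d_hypercyclicity_criterion ::
  "'b::ab_group_add set \<Rightarrow> ('b \<Rightarrow> real) \<Rightarrow> nat \<Rightarrow> (nat \<Rightarrow> 'b \<Rightarrow> 'b) \<Rightarrow> bool"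
  where "d_hypercyclicity_criterion X nrm N T \<longleftrightarrow>
    (\<forall>l\<in>{1..N}. T l ` X \<subseteq> X) \<and>
    (\<exists>(n :: nat \<Rightarrow> nat) (D :: nat \<Rightarrow> 'b set) (V :: nat \<Rightarrow> nat \<Rightarrow> 'b \<Rightarrow> 'b).
      strict_mono n \<and>
      (\<forall>l\<in>{0..N}. dense_in X nrm (D l)) \<and>
      (\<forall>l\<in>{1..N}. \<forall>k. V l k ` D l \<subseteq> X) \<and>
      (\<forall>l\<in>{1..N}. \<forall>x\<in>D 0. (\<lambda>k. nrm ((T l ^^ n k) x)) \<longlonglongrightarrow> 0) \<and>
      (\<forall>l\<in>{1..N}. \<forall>x\<in>D l. (\<lambda>k. nrm (V l k x)) \<longlonglongrightarrow> 0) \<and>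
      (\<forall>l\<in>{1..N}. \<forall>s\<in>{1..N}. s \<noteq> l \<longrightarrow>
        (\<forall>x\<in>D s. (\<lambda>k. nrm ((T l ^^ n k) (V s k x))) \<longlonglongrightarrow> 0)) \<and>
      (\<forall>l\<in>{1..N}. \<forall>x\<in>D l. (\<lambda>k. nrm ((T l ^^ n k) (V l k x) - x)) \<longlonglongrightarrow> 0))"

end

theory Submission
  imports Defs
begin

text \<open>
  For a unitary \<open>U\<close>, the powers of \<open>T\<^sub>l = mult_op U (W l) ^^ r l\<close> have the form
  \<open>F \<mapsto> W\<^sub>l\<^sup>i F U\<^sup>i\<close> with \<open>i = r l * n\<close>. The right factor is an isometric bijection, so all the
  growth sits in the left factor, which acts on each vector \<open>F v\<close> separately.

  From operators to vectors, evaluate at a single basis vector: the sets \<open>{F (e 0) | F \<in> D l}\<close> are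
  dense, and \<open>x = F (e 0)\<close> is sent to \<open>V l k F (U\<^sup>i (e 0))\<close>; every required limit follows since the
  operator norm is at most the norm of the ideal and \<open>U\<^sup>i\<close> is isometric. From vectors to operators,
  use the operators \<open>\<Sum>j<m. \<langle>_, e j\<rangle> x\<^sub>j\<close> with all \<open>x\<^sub>j \<in> D l\<close>, and let the new maps be
  \<open>(\<Sum>j<m. \<langle>_, e j\<rangle> V l k x\<^sub>j) U\<^sup>-\<^sup>i\<close>; the required limits are finite sums of rank-one norms. Both
  directions are \<open>criterion_operators_iff\<close>. The second claim follows because the identity is unitary.

  This argument needs only a few properties of the operator space, collected in the locale
  \<open>operator_ideal\<close>: it is stable under sums, under bounded operators on the left and
  under unitary ones on the right; its norm dominates the operator norm, satisfies the triangle
  inequality and is at most \<open>\<parallel>x\<parallel> \<parallel>y\<parallel>\<close> on rank-one operators, and \<open>F\<close> is approximated by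
  operators \<open>A P\<^sub>m\<close>, where \<open>P\<^sub>m\<close> projects onto the span of the first \<open>m\<close> basis vectors. Verifying them
  for the trace norm is the laborious part. It rests on the variational description
  \<open>\<parallel>T\<parallel>\<^sub>1 = sup {\<Sum>j<n. Re \<langle>T L e\<^sub>j, K e\<^sub>j\<rangle>}\<close> over \<open>n\<close> and contractions \<open>K\<close>, \<open>L\<close> (\<open>trace_normI\<close>,
  \<open>trace_norm_ge\<close>), from which the triangle inequality and the ideal property are immediate. The
  description follows from an approximate polar decomposition \<open>T \<approx> V |T|\<close> (\<open>polar_approx\<close>) and from
  the invariance of the Hilbert--Schmidt norm under adjoints (\<open>sum_adjoint_le\<close>), applied to
  \<open>|T|\<^sup>1\<^sup>/\<^sup>2\<close>.
\<close>

section \<open>Inner products and bounded operators\<close>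

lemma cinner_add_right: "cinner x (y + z) = cinner x y + cinner (x::'a::complex_hilbert) z"
  by (metis cinner_commute cinner_add_left complex_cnj_add)

lemma cinner_scaleC_right: "cinner x (c *\<^sub>C y) = cnj c * cinner (x::'a::complex_hilbert) y"
  by (metis cinner_commute cinner_scaleC_left complex_cnj_mult)

lemma cinner_scaleR_left: "cinner (a *\<^sub>R x) y = a *\<^sub>R cinner (x::'a::complex_hilbert) y"
  by (simp add: scaleR_scaleC cinner_scaleC_left scaleR_conv_of_real)

lemma cinner_scaleR_right: "cinner x (a *\<^sub>R y) = a *\<^sub>R cinner (x::'a::complex_hilbert) y"
  by (simp add: scaleR_scaleC cinner_scaleC_right scaleR_conv_of_real)

lemma bounded_opsD: "T \<in> bounded_ops \<Longrightarrow> T (c *\<^sub>C x) = c *\<^sub>C T x"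
  by (simp add: bounded_ops_def)

lemma Re_cinner_self: "Re (cinner x x) = (norm (x::'a::complex_hilbert))\<^sup>2"
  by (simp add: cinner_self)

lemma cinner_minus_left: "cinner (- x) y = - cinner (x::'a::complex_hilbert) y"
  using cinner_scaleR_left[of "-1" x y] by simp

lemma cinner_minus_right: "cinner x (- y) = - cinner (x::'a::complex_hilbert) y"
  using cinner_scaleR_right[of x "-1" y] by simp

lemma cinner_diff_left: "cinner (x - y) z = cinner x z - cinner (y::'a::complex_hilbert) z"
  using cinner_add_left[of x "- y" z] by (simp add: cinner_minus_left)

lemma cinner_diff_right: "cinner x (y - z) = cinner x y - cinner (x::'a::complex_hilbert) z"
  using cinner_add_right[of x y "- z"] by (simp add: cinner_minus_right)

lemmas cinner_simps = cinner_add_left cinner_add_right cinner_diff_left cinner_diff_right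
  cinner_minus_left cinner_minus_right cinner_scaleC_left cinner_scaleC_right
  cinner_scaleR_left cinner_scaleR_right

lemma norm_scaleC: "norm (c *\<^sub>C x) = cmod c * norm (x::'a::complex_hilbert)"
proof -
  have "cinner (c *\<^sub>C x) (c *\<^sub>C x) = (c * cnj c) * cinner x x"
    by (simp add: cinner_simps)
  also have "\<dots> = complex_of_real ((cmod c * norm x)\<^sup>2)"
    by (simp add: cinner_self complex_norm_square[symmetric] power_mult_distrib)
  finally have "cinner (c *\<^sub>C x) (c *\<^sub>C x) = complex_of_real ((cmod c * norm x)\<^sup>2)" .
  then have "(norm (c *\<^sub>C x))\<^sup>2 = (cmod c * norm x)\<^sup>2"
    by (metis cinner_self of_real_eq_iff)
  then show ?thesis by (simp add: power2_eq_iff_nonneg)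
qed

text \<open>By polarization, real diagonal values make a positive operator symmetric.\<close>

lemma positive_op_symmetric:
  assumes "positive_op P"
  shows "cinner (P x) y = cinner x (P y)"
proof -
  have P: "P \<in> bounded_ops" and im: "Im (cinner (P z) z) = 0" for z
    using assms by (auto simp: positive_op_def)
  have "Im (cinner (P x) y) + Im (cinner (P y) x) = 0"
    using im[of "x + y"] im[of x] im[of y] by (simp add: blinfun.add_right cinner_simps)
  moreover have "Re (cinner (P y) x) - Re (cinner (P x) y) = 0"
    using im[of "x + \<i> *\<^sub>C y"] im[of x] im[of y]
    by (simp add: blinfun.add_right cinner_simps bounded_opsD[OF P])
  ultimately have "cinner (P x) y = cnj (cinner (P y) x)"
    by (simp add: complex_eq_iff)
  then show ?thesis using cinner_commute by metis
qed

text \<open>The Cauchy--Schwarz inequality for the semi-inner product \<open>\<langle>P x, y\<rangle>\<close>.\<close>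

lemma positive_op_Cauchy_Schwarz:
  assumes "positive_op P"
  shows "(cmod (cinner (P x) y))\<^sup>2 \<le> Re (cinner (P x) x) * Re (cinner (P y) y)"
proof -
  \<comment> \<open>the form is nonnegative at \<open>x - t a y\<close>, a quadratic condition on the real number \<open>t\<close>\<close>
  define a p q where "a = cinner (P x) y" and "p = Re (cinner (P x) x)" and "q = Re (cinner (P y) y)"
  have P: "P \<in> bounded_ops" and ge: "0 \<le> Re (cinner (P z) z)" for z
    using assms by (auto simp: positive_op_def)
  have yx: "cinner (P y) x = cnj a"
    using positive_op_symmetric[OF assms] cinner_commute unfolding a_def by metis
  have quad: "0 \<le> p - 2 * t * (cmod a)\<^sup>2 + t\<^sup>2 * (cmod a)\<^sup>2 * q" for t :: real
  proof -
    have im: "Im (cinner (P y) y) = 0"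
      using assms by (auto simp: positive_op_def)
    define z where "z = x - (complex_of_real t * a) *\<^sub>C y"
    have "cinner (P z) z = cinner (P x) x - 2 * of_real t * (a * cnj a)
        + (of_real t)\<^sup>2 * (a * cnj a) * cinner (P y) y"
      unfolding z_def
      by (simp add: blinfun.diff_right cinner_simps bounded_opsD[OF P] yx a_def[symmetric]
          power2_eq_square algebra_simps)
    also have "\<dots> = cinner (P x) x - of_real (2 * t * (cmod a)\<^sup>2)
        + of_real (t\<^sup>2 * (cmod a)\<^sup>2) * cinner (P y) y"
      by (simp add: complex_norm_square[symmetric])
    finally have "cinner (P z) z = cinner (P x) x - of_real (2 * t * (cmod a)\<^sup>2)
        + of_real (t\<^sup>2 * (cmod a)\<^sup>2) * cinner (P y) y" .
    then show ?thesis using ge[of z] by (simp add: p_def q_def im)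
  qed
  show ?thesis
  proof (cases "q = 0")
    case True
    have "cmod a = 0"
    proof (rule ccontr)
      assume "cmod a \<noteq> 0"
      then show False using quad[of "(p + 1) / (2 * (cmod a)\<^sup>2)"] ge[of x] True
        by (simp add: p_def[symmetric] field_simps)
    qed
    then show ?thesis using True by (simp add: a_def q_def)
  next
    case False
    then have "q > 0" using ge[of y] by (simp add: q_def)
    then show ?thesis using quad[of "1 / q"]
      by (simp add: field_simps power2_eq_square a_def[symmetric] p_def[symmetric] q_def[symmetric])
  qed
qed

lemma positive_op_id: "positive_op id_blinfun"
  by (simp add: positive_op_def bounded_ops_def cinner_self)

lemma norm_cinner_le: "cmod (cinner x y) \<le> norm x * norm (y::'a::complex_hilbert)"
proof -
  have "(cmod (cinner x y))\<^sup>2 \<le> (norm x * norm y)\<^sup>2"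
    using positive_op_Cauchy_Schwarz[OF positive_op_id, of x y]
    by (simp add: Re_cinner_self power_mult_distrib)
  then show ?thesis by (simp add: power2_le_iff_abs_le)
qed

lemma bounded_bilinear_cinner: "bounded_bilinear (cinner :: 'a::complex_hilbert \<Rightarrow> _)"
  by (rule bounded_bilinear.intro)
    (auto simp: cinner_simps intro!: exI[of _ 1] norm_cinner_le)

lemma bounded_bilinear_scaleC: "bounded_bilinear (scaleC :: complex \<Rightarrow> 'a::complex_hilbert \<Rightarrow> _)"
  by (rule bounded_bilinear.intro)
    (auto simp: scaleC_add_left scaleC_add_right scaleR_scaleC scaleC_scaleC scaleR_conv_of_real
       norm_scaleC mult.commute intro!: exI[of _ 1])

lemmas cinner_sum_left = bounded_bilinear.sum_left[OF bounded_bilinear_cinner]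
lemmas cinner_sum_right = bounded_bilinear.sum_right[OF bounded_bilinear_cinner]
lemmas cinner_zero_left [simp] = bounded_bilinear.zero_left[OF bounded_bilinear_cinner]
lemmas cinner_zero_right [simp] = bounded_bilinear.zero_right[OF bounded_bilinear_cinner]
lemmas tendsto_cinner = bounded_bilinear.tendsto[OF bounded_bilinear_cinner]
lemmas tendsto_scaleC = bounded_bilinear.tendsto[OF bounded_bilinear_scaleC]

lemma cinner_ext:
  assumes "\<And>z. cinner z x = cinner z (y::'a::complex_hilbert)"
  shows "x = y"
proof -
  have "cinner (x - y) (x - y) = 0" using assms[of "x - y"] by (simp add: cinner_diff_right)
  then show ?thesis by (simp add: cinner_self)
qed

lemma Re_cinner_le_imp_norm_le:
  assumes "\<And>y. norm y \<le> 1 \<Longrightarrow> Re (cinner x y) \<le> c" and "0 \<le> c"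
  shows "norm (x::'a::complex_hilbert) \<le> c"
proof (cases "x = 0")
  case False
  have "Re (cinner x (x /\<^sub>R norm x)) = norm x"
    using False by (simp add: cinner_simps cinner_self power2_eq_square)
  then show ?thesis using assms(1)[of "x /\<^sub>R norm x"] False by simp
qed (use assms in simp)

lemma bounded_ops_compose [intro]: "S \<in> bounded_ops \<Longrightarrow> T \<in> bounded_ops \<Longrightarrow> S o\<^sub>L T \<in> bounded_ops"
  by (simp add: bounded_ops_def)
lemma bounded_ops_id [intro, simp]: "id_blinfun \<in> bounded_ops"
  by (simp add: bounded_ops_def)
lemma bounded_ops_zero [intro, simp]: "0 \<in> bounded_ops"
  by (simp add: bounded_ops_def)
lemma bounded_ops_add [intro]: "S \<in> bounded_ops \<Longrightarrow> T \<in> bounded_ops \<Longrightarrow> S + T \<in> bounded_ops"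
  by (simp add: bounded_ops_def blinfun.add_left scaleC_add_right)
lemma bounded_ops_scaleR [intro]: "T \<in> bounded_ops \<Longrightarrow> a *\<^sub>R T \<in> bounded_ops"
  by (simp add: bounded_ops_def blinfun.scaleR_left scaleR_scaleC scaleC_scaleC mult.commute)
lemma bounded_ops_diff [intro]: "S \<in> bounded_ops \<Longrightarrow> T \<in> bounded_ops \<Longrightarrow> S - T \<in> bounded_ops"
  using bounded_ops_add[of S "-1 *\<^sub>R T"] bounded_ops_scaleR[of T "-1"] by simp
lemma bounded_ops_sum [intro]: "(\<And>i. i \<in> A \<Longrightarrow> f i \<in> bounded_ops) \<Longrightarrow> sum f A \<in> bounded_ops"
  by (induction A rule: infinite_finite_induct) auto

lemma closed_bounded_ops: "closed (bounded_ops :: ('a::complex_hilbert \<Rightarrow>\<^sub>L 'a) set)"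
  unfolding closed_sequential_limits
proof (intro allI impI, elim conjE)
  fix T and S :: "'a \<Rightarrow>\<^sub>L 'a"
  assume T: "\<forall>n. T n \<in> bounded_ops" and lim: "T \<longlonglongrightarrow> S"
  have "S (c *\<^sub>C x) = c *\<^sub>C S x" for c x
  proof (rule LIMSEQ_unique)
    show "(\<lambda>n. T n (c *\<^sub>C x)) \<longlonglongrightarrow> S (c *\<^sub>C x)"
      by (intro blinfun.tendsto lim tendsto_const)
    have "(\<lambda>n. c *\<^sub>C T n x) \<longlonglongrightarrow> c *\<^sub>C S x"
      by (intro tendsto_scaleC blinfun.tendsto lim tendsto_const)
    then show "(\<lambda>n. T n (c *\<^sub>C x)) \<longlonglongrightarrow> c *\<^sub>C S x"
      using T by (simp add: bounded_opsD)
  qed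
  then show "S \<in> bounded_ops" by (simp add: bounded_ops_def)
qed

text \<open>The operator \<open>z \<mapsto> \<langle>z, y\<rangle> x\<close>.\<close>

definition rank_one :: "'a::complex_hilbert \<Rightarrow> 'a \<Rightarrow> ('a \<Rightarrow>\<^sub>L 'a)"
  where "rank_one x y = Blinfun (\<lambda>z. cinner z y *\<^sub>C x)"

lemma rank_one_apply: "rank_one x y z = cinner z y *\<^sub>C x"
  unfolding rank_one_def
  by (subst bounded_linear_Blinfun_apply)
    (auto intro!: bounded_linear_compose[OF bounded_bilinear.bounded_linear_left[OF bounded_bilinear_scaleC]]
      bounded_bilinear.bounded_linear_left[OF bounded_bilinear_cinner])

lemma rank_one_bounded_ops [intro, simp]: "rank_one x y \<in> bounded_ops"
  by (simp add: bounded_ops_def rank_one_apply cinner_simps scaleC_scaleC)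

lemma norm_rank_one_le: "norm (rank_one x y) \<le> norm x * norm y"
proof (rule norm_blinfun_bound)
  fix z
  show "norm (rank_one x y z) \<le> norm x * norm y * norm z"
    using mult_right_mono[OF norm_cinner_le[of z y] norm_ge_zero[of x]]
    by (simp add: rank_one_apply norm_scaleC algebra_simps)
qed simp

lemma compose_rank_one: "A \<in> bounded_ops \<Longrightarrow> A o\<^sub>L rank_one x y = rank_one (A x) y"
  by (rule blinfun_eqI) (simp add: rank_one_apply bounded_opsD)

lemma rank_one_diff_left: "rank_one x y - rank_one x' y = rank_one (x - x') y"
  by (rule blinfun_eqI) (simp add: rank_one_apply blinfun.diff_left
    bounded_bilinear.diff_right[OF bounded_bilinear_scaleC])

section \<open>Orthonormal bases and adjoints\<close>

text \<open>A complex Hilbert space with a fixed orthonormal basis indexed by the natural numbers.\<close>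

locale hilbert_basis =
  fixes e :: "nat \<Rightarrow> 'a::complex_hilbert"
  assumes onb: "orthonormal_basis e"
begin

lemma cinner_basis: "cinner (e i) (e j) = (if i = j then 1 else 0)"
  using onb by (simp add: orthonormal_basis_def)

lemma norm_basis [simp]: "norm (e i) = 1"
  using Re_cinner_self[of "e i"] norm_ge_zero[of "e i"] by (auto simp: cinner_basis power2_eq_1_iff)

lemma norm_sum_basis:
  assumes "finite A"
  shows "(norm (\<Sum>j\<in>A. c j *\<^sub>C e j))\<^sup>2 = (\<Sum>j\<in>A. (cmod (c j))\<^sup>2)"
proof -
  have "cinner (\<Sum>j\<in>A. c j *\<^sub>C e j) (\<Sum>j\<in>A. c j *\<^sub>C e j) = (\<Sum>j\<in>A. c j * cnj (c j))"
    using assms by (simp add: cinner_sum_left cinner_sum_right cinner_simps cinner_basis if_distrib mult.commute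
        cong: if_cong)
  also have "\<dots> = of_real (\<Sum>j\<in>A. (cmod (c j))\<^sup>2)"
    by (simp add: complex_norm_square del: of_real_power)
  finally show ?thesis
    by (metis Re_cinner_self Re_complex_of_real)
qed

text \<open>The orthogonal projection onto the span of the first \<open>n\<close> basis vectors.\<close>

definition proj :: "nat \<Rightarrow> ('a \<Rightarrow>\<^sub>L 'a)"
  where "proj n = (\<Sum>j<n. rank_one (e j) (e j))"

lemma proj_apply: "proj n x = (\<Sum>j<n. cinner x (e j) *\<^sub>C e j)"
  by (simp add: proj_def blinfun.sum_left rank_one_apply)

lemma proj_bounded_ops [intro, simp]: "proj n \<in> bounded_ops"
  unfolding proj_def by (intro bounded_ops_sum) simp

lemma proj_symmetric: "cinner (proj n x) y = cinner x (proj n y)"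
  by (simp add: proj_apply cinner_sum_left cinner_sum_right cinner_simps)
     (metis cinner_commute mult.commute)

lemma proj_basis: "proj n (e j) = (if j < n then e j else 0)"
proof -
  have "proj n (e j) = (\<Sum>i<n. if i = j then e j else 0)"
    unfolding proj_apply by (intro sum.cong) (auto simp: cinner_basis)
  then show ?thesis by simp
qed

lemma norm_proj_sq: "(norm (proj n x))\<^sup>2 = (\<Sum>j<n. (cmod (cinner x (e j)))\<^sup>2)"
  by (simp add: proj_apply norm_sum_basis)

lemma norm_proj_apply_le: "norm (proj n x) \<le> norm x"
proof -
  have idem: "proj n (proj n x) = proj n x"
    by (simp add: proj_apply[of n x] blinfun.sum_right bounded_opsD proj_basis)
  have "cinner (proj n x) (x - proj n x) = 0"
    using proj_symmetric[of n "proj n x" x] by (simp add: cinner_diff_right idem)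
  moreover have "cinner (x - proj n x) (proj n x) = 0"
    using calculation cinner_commute by (metis complex_cnj_zero)
  ultimately have "cinner x x = cinner (proj n x) (proj n x) + cinner (x - proj n x) (x - proj n x)"
    by (simp add: cinner_simps)
  then have "(norm x)\<^sup>2 = (norm (proj n x))\<^sup>2 + (norm (x - proj n x))\<^sup>2"
    by (metis Re_cinner_self plus_complex.sel(1))
  then have "(norm (proj n x))\<^sup>2 \<le> (norm x)\<^sup>2" by simp
  then show ?thesis by (simp add: power2_le_iff_abs_le)
qed

text \<open>
  The vectors approximated by their projections form a subspace containing the basis; since the
  projections are contractions, this extends to the closure of that subspace.
\<close>

lemma proj_tendsto: "(\<lambda>n. proj n x) \<longlonglongrightarrow> x"
proof -
  let ?S = "{x. (\<lambda>n. proj n x) \<longlonglongrightarrow> x}"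
  have "complex_vector.subspace ?S"
    by (rule complex_vector.subspaceI)
       (auto simp: blinfun.zero_right blinfun.add_right bounded_opsD intro: tendsto_add tendsto_scaleC)
  moreover have "range e \<subseteq> ?S"
  proof safe
    fix j
    have "eventually (\<lambda>n. proj n (e j) = e j) sequentially"
      using eventually_gt_at_top[of j] by eventually_elim (simp add: proj_basis)
    then show "(\<lambda>n. proj n (e j)) \<longlonglongrightarrow> e j" by (rule tendsto_eventually)
  qed
  ultimately have span: "cspan (range e) \<subseteq> ?S" by (rule complex_vector.span_minimal[rotated])
  show ?thesis
  proof (rule LIMSEQ_I)
    fix r :: real assume "r > 0"
    have "x \<in> closure (cspan (range e))" using onb by (simp add: orthonormal_basis_def)
    then obtain y where y: "y \<in> cspan (range e)" "dist y x < r / 3"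
      using \<open>r > 0\<close> by (metis closure_approachable divide_pos_pos zero_less_numeral)
    from y span have "(\<lambda>n. proj n y) \<longlonglongrightarrow> y" by auto
    then obtain m where m: "\<And>n. n \<ge> m \<Longrightarrow> norm (proj n y - y) < r / 3"
      using \<open>r > 0\<close> LIMSEQ_D[of "\<lambda>n. proj n y" y "r/3"] by auto
    have "norm (proj n x - x) < r" if "n \<ge> m" for n
    proof -
      have "proj n x - x = proj n (x - y) + (proj n y - y) + (y - x)"
        by (simp add: blinfun.diff_right)
      then have "norm (proj n x - x) \<le> norm (proj n (x - y)) + norm (proj n y - y) + norm (y - x)"
        by (metis norm_triangle_le norm_triangle_ineq add_mono order_refl)
      also have "\<dots> < r"
        using norm_proj_apply_le[of n "x - y"] m[OF that] y(2)
        by (simp add: dist_norm norm_minus_commute)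
      finally show ?thesis .
    qed
    then show "\<exists>no. \<forall>n\<ge>no. norm (proj n x - x) < r" by blast
  qed
qed

text \<open>Parseval's identity, and Bessel's inequality.\<close>

lemma Parseval: "(\<lambda>j. (cmod (cinner x (e j)))\<^sup>2) sums (norm x)\<^sup>2"
  unfolding sums_def norm_proj_sq[symmetric] by (intro tendsto_intros proj_tendsto)

lemma Bessel: "(\<Sum>j<n. (cmod (cinner x (e j)))\<^sup>2) \<le> (norm x)\<^sup>2"
  using norm_proj_apply_le[of n x] by (simp add: norm_proj_sq[symmetric] power_mono)

text \<open>The adjoint is given by the series \<open>\<Sum>j. \<langle>y, T e\<^sub>j\<rangle> e\<^sub>j\<close>.\<close>

lemma adjoint_exists:
  fixes T :: "'a \<Rightarrow>\<^sub>L 'a"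
  assumes T: "T \<in> bounded_ops"
  shows "\<exists>S. S \<in> bounded_ops \<and> (\<forall>x y. cinner (T x) y = cinner x (S y)) \<and> norm S \<le> norm T"
proof -
  define c where "c y j = cinner y (T (e j))" for y j
  define f where "f y n = (\<Sum>j<n. c y j *\<^sub>C e j)" for y n
  have f_le: "norm (f y n) \<le> norm T * norm y" for y n
  proof -
    have "cinner y (T (f y n)) = (\<Sum>j<n. c y j * cnj (c y j))"
      by (simp add: f_def blinfun.sum_right bounded_opsD[OF T] cinner_sum_right cinner_simps
          c_def[symmetric] mult.commute)
    also have "\<dots> = of_real ((norm (f y n))\<^sup>2)"
      by (simp add: f_def norm_sum_basis complex_norm_square del: of_real_power)
    finally have "(norm (f y n))\<^sup>2 \<le> norm y * norm (T (f y n))"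
      using norm_cinner_le[of y "T (f y n)"] by (simp add: norm_power del: of_real_power)
    also have "\<dots> \<le> norm y * (norm T * norm (f y n))"
      by (intro mult_left_mono norm_blinfun) simp
    finally show ?thesis by (cases "f y n = 0") (auto simp: power2_eq_square mult_ac)
  qed
  have conv: "convergent (f y)" for y
  proof -
    have "summable (\<lambda>j. (cmod (c y j))\<^sup>2)"
    proof (rule summableI_nonneg_bounded)
      show "(\<Sum>j<n. (cmod (c y j))\<^sup>2) \<le> (norm T * norm y)\<^sup>2" for n
        using power_mono[OF f_le[of y n], of 2] by (simp add: f_def norm_sum_basis)
    qed simp
    then have cau: "\<exists>M. \<forall>m\<ge>M. \<forall>n. norm (\<Sum>j=m..<n. (cmod (c y j))\<^sup>2) < r" if "r > 0" for r
      using that by (simp add: summable_Cauchy)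
    have "Cauchy (f y)"
    proof (rule CauchyI')
      fix r :: real assume r: "r > 0"
      then obtain M where M: "\<And>m n. m \<ge> M \<Longrightarrow> norm (\<Sum>j=m..<n. (cmod (c y j))\<^sup>2) < r\<^sup>2"
        using cau[of "r\<^sup>2"] by auto
      have "dist (f y m) (f y n) < r" if "m \<ge> M" "n > m" for m n
      proof -
        have "f y n - f y m = (\<Sum>j=m..<n. c y j *\<^sub>C e j)"
          unfolding f_def using that(2) by (metis lessThan_atLeast0 sum_diff_nat_ivl le0 less_imp_le)
        then have "(dist (f y m) (f y n))\<^sup>2 < r\<^sup>2"
          using M[of m n] that
          by (simp add: dist_norm norm_minus_commute[of "f y m"] norm_sum_basis sum_nonneg)
        then show ?thesis using r by (meson less_imp_le power2_less_imp_less)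
      qed
      then show "\<exists>M. \<forall>m\<ge>M. \<forall>n>m. dist (f y m) (f y n) < r" by blast
    qed
    then show ?thesis by (simp add: Cauchy_convergent)
  qed
  define g where "g y = lim (f y)" for y
  have g: "f y \<longlonglongrightarrow> g y" for y
    using conv[of y] by (simp add: g_def convergent_LIMSEQ_iff)
  have g_le: "norm (g y) \<le> norm T * norm y" for y
    using LIMSEQ_le_const2[OF tendsto_norm[OF g]] f_le by blast
  have adj: "cinner (T x) y = cinner x (g y)" for x y
  proof -
    have "(\<lambda>n. cinner x (f y n)) \<longlonglongrightarrow> cinner x (g y)"
      by (intro tendsto_cinner tendsto_const g)
    moreover have "cinner x (f y n) = cinner (T (proj n x)) y" for n
    proof -
      have "cinner x (f y n) = (\<Sum>j<n. cinner x (e j) * cnj (c y j))"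
        by (simp add: f_def cinner_sum_right cinner_simps mult.commute)
      also have "\<dots> = (\<Sum>j<n. cinner x (e j) * cinner (T (e j)) y)"
        unfolding c_def by (metis cinner_commute)
      finally show ?thesis
        by (simp add: proj_apply blinfun.sum_right bounded_opsD[OF T] cinner_sum_left cinner_simps)
    qed
    moreover have "(\<lambda>n. cinner (T (proj n x)) y) \<longlonglongrightarrow> cinner (T x) y"
      by (intro tendsto_cinner tendsto_const blinfun.tendsto proj_tendsto)
    ultimately show ?thesis using LIMSEQ_unique by auto
  qed
  have scale: "g (a *\<^sub>C y) = a *\<^sub>C g y" for a y
    by (rule cinner_ext) (simp add: adj[symmetric] cinner_simps)
  have "bounded_linear g"
  proof (rule bounded_linear_intro)
    show "g (x + y) = g x + g y" for x y
      by (rule cinner_ext) (simp add: adj[symmetric] cinner_simps)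
    show "g (a *\<^sub>R x) = a *\<^sub>R g x" for a x
      by (rule cinner_ext) (simp add: adj[symmetric] cinner_simps)
    show "norm (g x) \<le> norm x * norm T" for x
      using g_le[of x] by (simp add: mult.commute)
  qed
  then have app: "blinfun_apply (Blinfun g) = g" by (rule bounded_linear_Blinfun_apply)
  show ?thesis
    by (rule exI[of _ "Blinfun g"])
       (auto simp: bounded_ops_def app adj scale intro!: norm_blinfun_bound g_le)
qed

lemma adjoint_eqI:
  fixes T :: "'a \<Rightarrow>\<^sub>L 'a"
  assumes "S \<in> bounded_ops"
    and "\<And>x y. cinner (blinfun_apply T x) y = cinner x (blinfun_apply S y)"
  shows "adjoint_op T = S"
  unfolding adjoint_op_def
proof (rule the_equality)
  fix R assume "R \<in> bounded_ops \<and> (\<forall>x y. cinner (T x) y = cinner x (R y))"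
  then show "R = S" using assms(2) by (intro blinfun_eqI cinner_ext) metis
qed (use assms in auto)

lemma
  fixes T :: "'a \<Rightarrow>\<^sub>L 'a"
  assumes "T \<in> bounded_ops"
  shows adjoint_bounded_ops [simp]: "adjoint_op T \<in> bounded_ops"
    and cinner_adjoint: "cinner (T x) y = cinner x (adjoint_op T y)"
    and norm_adjoint_le: "norm (adjoint_op T) \<le> norm T"
  using adjoint_exists[OF assms] adjoint_eqI by metis+

lemma cinner_adjoint': "(T :: 'a \<Rightarrow>\<^sub>L 'a) \<in> bounded_ops \<Longrightarrow> cinner (adjoint_op T x) y = cinner x (T y)"
  using cinner_adjoint cinner_commute by metis

lemma adjoint_adjoint: "(T :: 'a \<Rightarrow>\<^sub>L 'a) \<in> bounded_ops \<Longrightarrow> adjoint_op (adjoint_op T) = T"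
  by (rule adjoint_eqI) (simp_all add: cinner_adjoint')

lemma adjoint_compose:
  "(S :: 'a \<Rightarrow>\<^sub>L 'a) \<in> bounded_ops \<Longrightarrow> T \<in> bounded_ops \<Longrightarrow> adjoint_op (S o\<^sub>L T) = adjoint_op T o\<^sub>L adjoint_op S"
  by (rule adjoint_eqI) (auto simp: cinner_adjoint)

lemma unitary_norm:
  fixes U :: "'a \<Rightarrow>\<^sub>L 'a"
  assumes U: "unitary_op U"
  shows "norm (U x) = norm x"
proof -
  have "adjoint_op U (U x) = x"
    using U unfolding unitary_op_def by (metis blinfun_apply_blinfun_compose id_blinfun.rep_eq)
  moreover have "cinner (U x) (U x) = cinner x (adjoint_op U (U x))"
    using U by (simp add: unitary_op_def cinner_adjoint)
  ultimately have "cinner (U x) (U x) = cinner x x" by simp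
  then show ?thesis
    by (metis Re_cinner_self norm_ge_zero power2_eq_iff_nonneg)
qed

lemma rank_one_compose: "(A :: 'a \<Rightarrow>\<^sub>L 'a) \<in> bounded_ops \<Longrightarrow> rank_one x y o\<^sub>L A = rank_one x (adjoint_op A y)"
  by (rule blinfun_eqI) (simp add: rank_one_apply cinner_adjoint)

lemma compose_proj: "A \<in> bounded_ops \<Longrightarrow> A o\<^sub>L proj n = (\<Sum>j<n. rank_one (A (e j)) (e j))"
  by (rule blinfun_eqI)
     (simp add: proj_apply blinfun.sum_left blinfun.sum_right rank_one_apply bounded_opsD)

text \<open>
  The Hilbert--Schmidt norm of the adjoint is at most that of the operator: expand every
  \<open>\<parallel>A\<^sup>* e\<^sub>j\<parallel>\<^sup>2\<close> by Parseval and apply Bessel to \<open>A e\<^sub>i\<close>.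
\<close>

lemma sum_adjoint_le:
  assumes A: "A \<in> bounded_ops" and sm: "summable (\<lambda>i. (norm (A (e i)))\<^sup>2)"
  shows "(\<Sum>j<n. (norm (adjoint_op A (e j)))\<^sup>2) \<le> (\<Sum>i. (norm (A (e i)))\<^sup>2)"
proof -
  have "(\<lambda>i. \<Sum>j<n. (cmod (cinner (adjoint_op A (e j)) (e i)))\<^sup>2)
      sums (\<Sum>j<n. (norm (adjoint_op A (e j)))\<^sup>2)"
    by (intro sums_sum Parseval)
  moreover have "(\<Sum>j<n. (cmod (cinner (adjoint_op A (e j)) (e i)))\<^sup>2) \<le> (norm (A (e i)))\<^sup>2" for i
  proof -
    have "cmod (cinner (adjoint_op A (e j)) (e i)) = cmod (cinner (A (e i)) (e j))" for j
      by (metis cinner_adjoint'[OF A] cinner_commute complex_mod_cnj)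
    then show ?thesis using Bessel by simp
  qed
  ultimately show ?thesis
    using sm by (metis (no_types, lifting) sums_le summable_sums)
qed

end

section \<open>Positive square roots and the absolute value\<close>

lemmas blinfun_compose_diff_left = bounded_bilinear.diff_left[OF bounded_bilinear_blinfun_compose]
lemmas blinfun_compose_diff_right = bounded_bilinear.diff_right[OF bounded_bilinear_blinfun_compose]

lemma norm_blinfun_contract: "norm (K :: 'a::real_normed_vector \<Rightarrow>\<^sub>L 'b::real_normed_vector) \<le> 1 \<Longrightarrow> norm (K x) \<le> norm x"
  using norm_blinfun[of K x] mult_right_mono[of "norm K" 1 "norm x"] by simp

text \<open>The Cauchy--Schwarz inequality for \<open>P\<close> passes the bound from the quadratic form to the norm.\<close>

lemma norm_positive_op_le:
  assumes P: "positive_op P" and le: "\<And>x. Re (cinner (P x) x) \<le> c * (norm x)\<^sup>2" and c: "0 \<le> c"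
  shows "norm P \<le> c"
proof (rule norm_blinfun_bound[OF c])
  fix x
  show "norm (P x) \<le> c * norm x"
  proof (rule Re_cinner_le_imp_norm_le)
    fix y :: 'a assume y: "norm y \<le> 1"
    have nn: "0 \<le> Re (cinner (P z) z)" for z using P by (simp add: positive_op_def)
    have "(cmod (cinner (P x) y))\<^sup>2 \<le> (c * (norm x)\<^sup>2) * (c * (norm y)\<^sup>2)"
      using positive_op_Cauchy_Schwarz[OF P, of x y] mult_mono[OF le[of x] le[of y]] nn c
      by (simp add: order_trans)
    also have "\<dots> \<le> (c * (norm x)\<^sup>2) * (c * 1)"
      using y c by (intro mult_left_mono) (simp_all add: power_le_one)
    also have "\<dots> = (c * norm x)\<^sup>2" by (simp add: power2_eq_square)
    finally have "cmod (cinner (P x) y) \<le> c * norm x"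
      using c by (simp add: power2_le_iff_abs_le)
    then show "Re (cinner (P x) y) \<le> c * norm x" using complex_Re_le_cmod order_trans by blast
  qed (use c in simp)
qed

lemma positive_op_scaleR: "positive_op P \<Longrightarrow> 0 \<le> a \<Longrightarrow> positive_op (a *\<^sub>R P)"
  by (auto simp: positive_op_def blinfun.scaleR_left cinner_simps)

lemma positive_op_id_minus:
  assumes X: "X \<in> bounded_ops" and sym: "\<And>x y. cinner (X x) y = cinner x (X y)" and le: "norm X \<le> 1"
  shows "positive_op (id_blinfun - X)"
proof -
  have "Im (cinner (X x) x) = 0" for x
    using sym[of x x] cinner_commute[of x "X x"] by (simp add: complex_eq_iff)
  moreover have "Re (cinner (X x) x) \<le> (norm x)\<^sup>2" for x
  proof -
    have "Re (cinner (X x) x) \<le> norm (X x) * norm x"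
      using complex_Re_le_cmod norm_cinner_le order_trans by blast
    also have "\<dots> \<le> norm x * norm x"
      by (intro mult_right_mono norm_blinfun_contract le) simp
    finally show ?thesis by (simp add: power2_eq_square)
  qed
  ultimately show ?thesis
    using X by (auto simp: positive_op_def blinfun.diff_left cinner_simps cinner_self)
qed

text \<open>
  The positive square root of a positive contraction \<open>A = 1 - X\<close> is \<open>1 - Y\<close>, where \<open>Y\<close> solves
  \<open>Y = (X + Y\<^sup>2) / 2\<close>. The iteration that starts at \<open>0\<close> converges in operator norm: its increments
  are dominated by those of the scalar iteration \<open>y \<mapsto> (1 + y\<^sup>2) / 2\<close>, which increases to \<open>1\<close>.
\<close>

fun sqrt_iter :: "('a::real_normed_vector \<Rightarrow>\<^sub>L 'a) \<Rightarrow> nat \<Rightarrow> ('a \<Rightarrow>\<^sub>L 'a)" where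
  "sqrt_iter X 0 = 0"
| "sqrt_iter X (Suc n) = (1 / 2) *\<^sub>R (X + (sqrt_iter X n o\<^sub>L sqrt_iter X n))"

text \<open>The dominating scalar iteration.\<close>

fun scalar_iter :: "nat \<Rightarrow> real" where
  "scalar_iter 0 = 0"
| "scalar_iter (Suc n) = (1 + (scalar_iter n)\<^sup>2) / 2"

lemma scalar_iter_bounds: "0 \<le> scalar_iter n \<and> scalar_iter n \<le> 1"
  by (induction n) (auto simp: power_le_one)

lemma scalar_iter_mono: "scalar_iter n \<le> scalar_iter (Suc n)"
  using zero_le_power2[of "1 - scalar_iter n"] by (simp add: power2_eq_square algebra_simps)

lemma convergent_scalar_iter: "convergent scalar_iter"
  by (rule Bseq_monoseq_convergent)
     (auto simp: Bseq_def monoseq_Suc scalar_iter_mono scalar_iter_bounds abs_of_nonneg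
       intro!: exI[of _ 1] simp del: scalar_iter.simps)

lemma norm_sqrt_iter:
  assumes X: "norm X \<le> 1"
  shows "norm (sqrt_iter X n) \<le> scalar_iter n"
    and "norm (sqrt_iter X (Suc n) - sqrt_iter X n) \<le> scalar_iter (Suc n) - scalar_iter n"
proof -
  have 1: "norm (sqrt_iter X n) \<le> scalar_iter n" for n
  proof (induction n)
    case (Suc n)
    have "norm (sqrt_iter X n o\<^sub>L sqrt_iter X n) \<le> (scalar_iter n)\<^sup>2"
      using norm_blinfun_compose[of "sqrt_iter X n" "sqrt_iter X n"] power_mono[OF Suc, of 2]
      by (simp add: power2_eq_square)
    then show ?case
      using norm_triangle_ineq[of X "sqrt_iter X n o\<^sub>L sqrt_iter X n"] X by simp
  qed simp
  show "norm (sqrt_iter X n) \<le> scalar_iter n" by (rule 1)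
  show "norm (sqrt_iter X (Suc n) - sqrt_iter X n) \<le> scalar_iter (Suc n) - scalar_iter n"
  proof (induction n)
    case 0
    then show ?case using X by simp
  next
    case (Suc n)
    let ?Y = "sqrt_iter X (Suc n)" and ?Z = "sqrt_iter X n"
    let ?y = "scalar_iter (Suc n)" and ?z = "scalar_iter n"
    have "sqrt_iter X (Suc (Suc n)) - ?Y = (1 / 2) *\<^sub>R ((?Y o\<^sub>L (?Y - ?Z)) + ((?Y - ?Z) o\<^sub>L ?Z))"
      unfolding sqrt_iter.simps(2)[of X "Suc n"]
      by (subst (3) sqrt_iter.simps(2))
         (simp add: blinfun_compose_diff_left blinfun_compose_diff_right scaleR_diff_right[symmetric]
           del: sqrt_iter.simps)
    then have "norm (sqrt_iter X (Suc (Suc n)) - ?Y)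
        \<le> (norm (?Y o\<^sub>L (?Y - ?Z)) + norm ((?Y - ?Z) o\<^sub>L ?Z)) / 2"
      using norm_triangle_ineq[of "?Y o\<^sub>L (?Y - ?Z)" "(?Y - ?Z) o\<^sub>L ?Z"]
      by (simp del: sqrt_iter.simps)
    also have "norm (?Y o\<^sub>L (?Y - ?Z)) \<le> ?y * (?y - ?z)"
      using norm_blinfun_compose[of ?Y "?Y - ?Z"]
        mult_mono[OF 1[of "Suc n"] Suc] scalar_iter_bounds[of "Suc n"]
      by (simp del: sqrt_iter.simps scalar_iter.simps)
    also have "norm ((?Y - ?Z) o\<^sub>L ?Z) \<le> (?y - ?z) * ?z"
      using norm_blinfun_compose[of "?Y - ?Z" ?Z]
        mult_mono[OF Suc 1[of n]] scalar_iter_mono[of n]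
      by (simp del: sqrt_iter.simps scalar_iter.simps)
    also have "(?y * (?y - ?z) + (?y - ?z) * ?z) / 2 = scalar_iter (Suc (Suc n)) - ?y"
      by (subst (2) scalar_iter.simps(2), subst (3) scalar_iter.simps(2))
         (simp add: power2_eq_square algebra_simps diff_divide_distrib add_divide_distrib)
    finally show ?case by simp
  qed
qed

lemma sqrt_iter_limit:
  fixes X :: "'a::banach \<Rightarrow>\<^sub>L 'a"
  assumes X: "norm X \<le> 1"
  obtains Y where "sqrt_iter X \<longlonglongrightarrow> Y"
proof -
  have *: "norm (sqrt_iter X (m + k) - sqrt_iter X m) \<le> scalar_iter (m + k) - scalar_iter m" for m k
  proof (induction k)
    case (Suc k)
    have "sqrt_iter X (m + Suc k) - sqrt_iter X m
        = (sqrt_iter X (Suc (m + k)) - sqrt_iter X (m + k)) + (sqrt_iter X (m + k) - sqrt_iter X m)"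
      by simp
    then have "norm (sqrt_iter X (m + Suc k) - sqrt_iter X m)
        \<le> norm (sqrt_iter X (Suc (m + k)) - sqrt_iter X (m + k)) + norm (sqrt_iter X (m + k) - sqrt_iter X m)"
      by (metis norm_triangle_ineq)
    then show ?case using norm_sqrt_iter(2)[OF X, of "m + k"] Suc
      by (simp del: sqrt_iter.simps scalar_iter.simps)
  qed simp
  have "Cauchy (sqrt_iter X)"
  proof (rule CauchyI')
    fix r :: real assume "r > 0"
    then obtain M where M: "\<And>m n. m \<ge> M \<Longrightarrow> n \<ge> M \<Longrightarrow> norm (scalar_iter m - scalar_iter n) < r"
      using CauchyD[OF convergent_Cauchy[OF convergent_scalar_iter]] by blast
    have "dist (sqrt_iter X m) (sqrt_iter X n) < r" if "m \<ge> M" and lt: "n > m" for m n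
    proof -
      obtain k where n: "n = m + k" using lt less_imp_add_positive by blast
      have "dist (sqrt_iter X m) (sqrt_iter X n) \<le> scalar_iter n - scalar_iter m"
        using *[of m k] by (simp add: n dist_norm norm_minus_commute)
      then show ?thesis using M[of n m] that by simp
    qed
    then show "\<exists>M. \<forall>m\<ge>M. \<forall>n>m. dist (sqrt_iter X m) (sqrt_iter X n) < r" by blast
  qed
  then show ?thesis using that by (auto simp: Cauchy_convergent_iff convergent_def)
qed

text \<open>
  The commutation property passes from \<open>A\<close> to all iterates and to their limit; it is what makes
  the square root unique.
\<close>

lemma sqrt_contraction_exists:
  assumes A: "positive_op A" and le: "norm A \<le> 1"
  shows "\<exists>P. positive_op P \<and> P o\<^sub>L P = A \<and>
    (\<forall>C. C o\<^sub>L A = A o\<^sub>L C \<longrightarrow> C o\<^sub>L P = P o\<^sub>L C)"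
proof -
  have Ab: "A \<in> bounded_ops" using A by (simp add: positive_op_def)
  define X where "X = id_blinfun - A"
  have Xb: "X \<in> bounded_ops" using Ab by (auto simp: X_def)
  have Xsym: "cinner (X x) y = cinner x (X y)" for x y
    by (simp add: X_def blinfun.diff_left cinner_simps positive_op_symmetric[OF A])
  have Xpos: "positive_op X"
    unfolding X_def by (rule positive_op_id_minus[OF Ab positive_op_symmetric[OF A] le])
  have Xle: "norm X \<le> 1"
  proof (rule norm_positive_op_le[OF Xpos])
    fix x have "0 \<le> Re (cinner (A x) x)" using A by (simp add: positive_op_def)
    then show "Re (cinner (X x) x) \<le> 1 * (norm x)\<^sup>2"
      by (simp add: X_def blinfun.diff_left cinner_simps cinner_self)
  qed simp
  obtain Y where Y: "sqrt_iter X \<longlonglongrightarrow> Y" using sqrt_iter_limit[OF Xle] .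
  have iter_b: "sqrt_iter X n \<in> bounded_ops" for n
    by (induction n) (auto intro: Xb)
  then have Yb: "Y \<in> bounded_ops"
    using closed_sequentially[OF closed_bounded_ops _ Y] by blast
  have iter_sym: "cinner (sqrt_iter X n x) y = cinner x (sqrt_iter X n y)" for n x y
    by (induction n arbitrary: x y) (simp_all add: blinfun.add_left blinfun.scaleR_left cinner_simps Xsym)
  have Ysym: "cinner (Y x) y = cinner x (Y y)" for x y
  proof (rule LIMSEQ_unique)
    show "(\<lambda>n. cinner (sqrt_iter X n x) y) \<longlonglongrightarrow> cinner (Y x) y"
      by (intro tendsto_cinner blinfun.tendsto Y tendsto_const)
    show "(\<lambda>n. cinner (sqrt_iter X n x) y) \<longlonglongrightarrow> cinner x (Y y)"
      unfolding iter_sym by (intro tendsto_cinner blinfun.tendsto Y tendsto_const)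
  qed
  have Yle: "norm Y \<le> 1"
    using LIMSEQ_le_const2[OF tendsto_norm[OF Y]] norm_sqrt_iter(1)[OF Xle] scalar_iter_bounds
    by (meson order_trans)
  have "(\<lambda>n. sqrt_iter X (Suc n)) \<longlonglongrightarrow> (1 / 2) *\<^sub>R (X + (Y o\<^sub>L Y))"
    unfolding sqrt_iter.simps
    by (intro tendsto_intros Y bounded_bilinear.tendsto[OF bounded_bilinear_blinfun_compose])
  then have Yeq: "Y = (1 / 2) *\<^sub>R (X + (Y o\<^sub>L Y))"
    using LIMSEQ_Suc[OF Y] LIMSEQ_unique by blast
  define P where "P = id_blinfun - Y"
  have "P o\<^sub>L P = A"
  proof (rule blinfun_eqI)
    fix x
    have Yx: "Y x = (1 / 2) *\<^sub>R (x - A x + Y (Y x))"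
      by (subst Yeq) (simp add: X_def blinfun.diff_left blinfun.add_left blinfun.scaleR_left)
    have "2 *\<^sub>R Y x = x - A x + Y (Y x)" by (subst Yx) simp
    then show "(P o\<^sub>L P) x = A x"
      by (simp add: P_def blinfun.diff_left blinfun.diff_right scaleR_2 algebra_simps)
  qed
  moreover have "positive_op P"
    unfolding P_def by (rule positive_op_id_minus[OF Yb Ysym Yle])
  moreover have "C o\<^sub>L P = P o\<^sub>L C" if C: "C o\<^sub>L A = A o\<^sub>L C" for C
  proof -
    have CX: "C (X x) = X (C x)" for x
      using arg_cong[OF C, of "\<lambda>T. T x"] by (simp add: X_def blinfun.diff_left blinfun.diff_right)
    have iter: "C (sqrt_iter X n x) = sqrt_iter X n (C x)" for n x
      by (induction n arbitrary: x)
         (simp_all add: blinfun.add_left blinfun.add_right blinfun.scaleR_left blinfun.scaleR_right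
           blinfun.zero_right CX)
    have "C (Y x) = Y (C x)" for x
    proof (rule LIMSEQ_unique)
      show "(\<lambda>n. C (sqrt_iter X n x)) \<longlonglongrightarrow> C (Y x)"
        by (intro blinfun.tendsto Y tendsto_const)
      show "(\<lambda>n. C (sqrt_iter X n x)) \<longlonglongrightarrow> Y (C x)"
        unfolding iter by (intro blinfun.tendsto Y tendsto_const)
    qed
    then show ?thesis
      by (intro blinfun_eqI) (simp add: P_def blinfun.diff_left blinfun.diff_right)
  qed
  ultimately show ?thesis by blast
qed

lemma sqrt_exists:
  assumes A: "positive_op A"
  shows "\<exists>P. positive_op P \<and> P o\<^sub>L P = A \<and>
    (\<forall>C. C o\<^sub>L A = A o\<^sub>L C \<longrightarrow> C o\<^sub>L P = P o\<^sub>L C)"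
proof -
  define c where "c = 1 + norm A"
  have c: "c > 0" by (simp add: c_def add_pos_nonneg)
  have "norm ((1 / c) *\<^sub>R A) \<le> 1" using c by (simp add: c_def divide_simps)
  moreover have "positive_op ((1 / c) *\<^sub>R A)" using positive_op_scaleR[OF A, of "1 / c"] c by simp
  ultimately obtain P where *: "positive_op P \<and> P o\<^sub>L P = (1 / c) *\<^sub>R A \<and>
      (\<forall>C. C o\<^sub>L ((1 / c) *\<^sub>R A) = ((1 / c) *\<^sub>R A) o\<^sub>L C \<longrightarrow> C o\<^sub>L P = P o\<^sub>L C)"
    using sqrt_contraction_exists by blast
  then have P: "positive_op P" "P o\<^sub>L P = (1 / c) *\<^sub>R A" by blast+
  note sc = bounded_bilinear.scaleR_left[OF bounded_bilinear_blinfun_compose]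
    bounded_bilinear.scaleR_right[OF bounded_bilinear_blinfun_compose]
  have "(sqrt c *\<^sub>R P) o\<^sub>L (sqrt c *\<^sub>R P) = A"
    using c by (simp add: sc P(2))
  moreover have "C o\<^sub>L (sqrt c *\<^sub>R P) = (sqrt c *\<^sub>R P) o\<^sub>L C" if C: "C o\<^sub>L A = A o\<^sub>L C" for C
  proof -
    have "C o\<^sub>L ((1 / c) *\<^sub>R A) = ((1 / c) *\<^sub>R A) o\<^sub>L C" by (simp only: sc C)
    then have "C o\<^sub>L P = P o\<^sub>L C" using * by blast
    then show ?thesis by (simp only: sc)
  qed
  moreover have "positive_op (sqrt c *\<^sub>R P)" using positive_op_scaleR[OF P(1), of "sqrt c"] c by simp
  ultimately show ?thesis by blast
qed

lemma positive_op_zero: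
  assumes "positive_op P" "Re (cinner (P x) x) = 0"
  shows "P x = 0"
proof -
  have "(cmod (cinner (P x) (P x)))\<^sup>2 \<le> 0"
    using positive_op_Cauchy_Schwarz[OF assms(1), of x "P x"] assms(2) by simp
  then show ?thesis by (simp add: cinner_self)
qed

text \<open>
  For commuting \<open>P\<close> and \<open>Q\<close> with equal squares, \<open>(P + Q) (P - Q) = 0\<close>, so both forms vanish at
  \<open>y = (P - Q) x\<close> and hence \<open>P y = Q y = 0\<close>.
\<close>

lemma sqrt_unique:
  assumes P: "positive_op P" and Q: "positive_op Q" and eq: "P o\<^sub>L P = Q o\<^sub>L Q"
    and comm: "Q o\<^sub>L P = P o\<^sub>L Q"
  shows "P = Q"
proof (rule blinfun_eqI)
  fix x
  define y where "y = P x - Q x"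
  have "P y + Q y = 0"
    using arg_cong[OF eq, of "\<lambda>T. T x"] arg_cong[OF comm, of "\<lambda>T. T x"]
    by (simp add: y_def blinfun.diff_right)
  then have "cinner (P y + Q y) y = 0" by simp
  then have "Re (cinner (P y) y) + Re (cinner (Q y) y) = 0"
    by (metis cinner_add_left plus_complex.sel(1) zero_complex.sel(1))
  moreover have "0 \<le> Re (cinner (P y) y)" "0 \<le> Re (cinner (Q y) y)"
    using P Q by (auto simp: positive_op_def)
  ultimately have "P y = 0" "Q y = 0"
    by (auto intro!: positive_op_zero P Q)
  moreover have "cinner y z = cinner x (P z) - cinner x (Q z)" for z
    by (simp add: y_def cinner_diff_left positive_op_symmetric[OF P] positive_op_symmetric[OF Q])
  ultimately have "cinner y y = 0" by simp
  then show "P x = Q x" by (simp add: cinner_self y_def)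
qed

lemma positive_sqrt_ex1:
  assumes A: "positive_op A"
  shows "\<exists>!P. positive_op P \<and> P o\<^sub>L P = A"
proof -
  obtain P where P: "positive_op P" "P o\<^sub>L P = A"
    and comm: "\<And>C. C o\<^sub>L A = A o\<^sub>L C \<Longrightarrow> C o\<^sub>L P = P o\<^sub>L C"
    using sqrt_exists[OF A] by blast
  show ?thesis
  proof (rule ex1I[of _ P])
    fix Q assume Q: "positive_op Q \<and> Q o\<^sub>L Q = A"
    have "Q o\<^sub>L A = A o\<^sub>L Q" using Q by (metis blinfun_eqI blinfun_apply_blinfun_compose)
    then have "Q o\<^sub>L P = P o\<^sub>L Q" by (rule comm)
    then show "Q = P" using sqrt_unique[of P Q] P Q by simp
  qed (use P in simp)
qed

context hilbert_basis
begin

lemma positive_op_adjoint_compose: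
  fixes T :: "'a \<Rightarrow>\<^sub>L 'a"
  assumes T: "T \<in> bounded_ops"
  shows "positive_op (adjoint_op T o\<^sub>L T)"
  using T by (auto simp: positive_op_def cinner_adjoint' cinner_self)

lemma
  fixes T :: "'a \<Rightarrow>\<^sub>L 'a"
  assumes T: "T \<in> bounded_ops"
  shows positive_abs_op: "positive_op (abs_op T)"
    and abs_op_square: "abs_op T o\<^sub>L abs_op T = adjoint_op T o\<^sub>L T"
  using theI'[OF positive_sqrt_ex1[OF positive_op_adjoint_compose[OF T]]]
  unfolding abs_op_def by auto

lemma norm_abs_op_apply:
  fixes T :: "'a \<Rightarrow>\<^sub>L 'a"
  assumes T: "T \<in> bounded_ops"
  shows "norm (abs_op T x) = norm (T x)"
proof -
  have "cinner (abs_op T x) (abs_op T x) = cinner (T x) (T x)"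
    using arg_cong[OF abs_op_square[OF T], of "\<lambda>S. S x"]
    by (simp add: positive_op_symmetric[OF positive_abs_op[OF T]] cinner_adjoint[OF T])
  then show ?thesis by (metis Re_cinner_self norm_ge_zero power2_eq_iff_nonneg)
qed

end

section \<open>Approximate polar decomposition and the trace norm\<close>

text \<open>
  \<open>P + \<epsilon>\<close> is invertible for positive \<open>P\<close>: with \<open>c = \<parallel>P\<parallel> + \<epsilon>\<close>, the operator
  \<open>D = 1 - (P + \<epsilon>) / c\<close> has norm at most \<open>1 - \<epsilon> / c\<close>, and the inverse is the fixed point of the
  contraction \<open>Z \<mapsto> D Z + 1 / c\<close>.
\<close>

lemma positive_resolvent:
  assumes P: "positive_op P" and \<epsilon>: "\<epsilon> > 0"
  shows "\<exists>R\<in>bounded_ops. \<forall>x. P (R x) + \<epsilon> *\<^sub>R R x = x \<and> R (P x + \<epsilon> *\<^sub>R x) = x"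
proof -
  have Pb: "P \<in> bounded_ops" using P by (simp add: positive_op_def)
  define M where "M = P + \<epsilon> *\<^sub>R id_blinfun"
  define c where "c = norm P + \<epsilon>"
  have c: "c > 0" using \<epsilon> by (simp add: c_def add_nonneg_pos)
  have ec: "\<epsilon> / c \<le> 1" "0 < \<epsilon> / c" using \<epsilon> c by (simp_all add: c_def)
  define D where "D = id_blinfun - (1 / c) *\<^sub>R M"
  have Mb: "M \<in> bounded_ops" using Pb by (auto simp: M_def)
  have M: "M x = P x + \<epsilon> *\<^sub>R x" for x by (simp add: M_def blinfun.add_left blinfun.scaleR_left)
  have Db: "D \<in> bounded_ops" using Mb by (auto simp: D_def)
  have "positive_op D" unfolding D_def
  proof (rule positive_op_id_minus)
    show "cinner (((1 / c) *\<^sub>R M) x) y = cinner x (((1 / c) *\<^sub>R M) y)" for x y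
      by (simp add: blinfun.scaleR_left M cinner_simps positive_op_symmetric[OF P])
    have "\<epsilon> * norm (id_blinfun :: 'a \<Rightarrow>\<^sub>L 'a) \<le> \<epsilon>"
      using \<epsilon> norm_blinfun_id_le by (intro mult_left_le) auto
    then have "norm M \<le> c"
      unfolding M_def c_def using norm_triangle_ineq[of P "\<epsilon> *\<^sub>R id_blinfun"] \<epsilon>
      by (simp only: norm_scaleR abs_of_pos)
    then show "norm ((1 / c) *\<^sub>R M) \<le> 1" using c by simp
  qed (use Mb in auto)
  then have "norm D \<le> 1 - \<epsilon> / c"
  proof (rule norm_positive_op_le)
    fix x
    have "0 \<le> Re (cinner (P x) x)" using P by (simp add: positive_op_def)
    then show "Re (cinner (D x) x) \<le> (1 - \<epsilon> / c) * (norm x)\<^sup>2"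
      using c by (simp add: D_def blinfun.diff_left blinfun.scaleR_left M cinner_simps cinner_self field_simps)
  qed (use ec in simp)
  then have contr: "norm (D o\<^sub>L Z) \<le> (1 - \<epsilon> / c) * norm Z" for Z
    using norm_blinfun_compose[of D Z] mult_right_mono[of "norm D" "1 - \<epsilon> / c" "norm Z"] by simp
  define f where "f Z = (D o\<^sub>L Z) + (1 / c) *\<^sub>R id_blinfun" for Z
  have "\<exists>!R\<in>bounded_ops. f R = R"
  proof (rule Banach_fix)
    show "complete (bounded_ops :: ('a \<Rightarrow>\<^sub>L 'a) set)"
      by (simp add: complete_eq_closed closed_bounded_ops)
    show "(bounded_ops :: ('a \<Rightarrow>\<^sub>L 'a) set) \<noteq> {}" using bounded_ops_id by blast
    show "f ` bounded_ops \<subseteq> bounded_ops" using Db by (auto simp: f_def)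
    show "0 \<le> 1 - \<epsilon> / c" "1 - \<epsilon> / c < 1" using ec by auto
    fix Y Z
    show "dist (f Y) (f Z) \<le> (1 - \<epsilon> / c) * dist Y Z"
      using contr[of "Y - Z"] by (simp add: dist_norm f_def blinfun_compose_diff_right)
  qed
  then obtain R where Rb: "R \<in> bounded_ops" and R: "f R = R" by blast
  have MR: "M (R x) = x" for x
    using arg_cong[OF R, of "\<lambda>T. T x"] c
    by (simp add: f_def D_def blinfun.add_left blinfun.diff_left blinfun.scaleR_left
        scaleR_diff_right[symmetric] field_simps)
  have inj: "x = 0" if "M x = 0" for x
  proof -
    have "cinner (M x) x = 0" using that by simp
    then have "Re (cinner (P x) x) + \<epsilon> * (norm x)\<^sup>2 = 0"
      by (simp add: M cinner_simps cinner_self complex_eq_iff)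
    moreover have "0 \<le> Re (cinner (P x) x)" using P by (simp add: positive_op_def)
    ultimately show ?thesis using \<epsilon>
      by (metis add_nonneg_eq_0_iff mult_eq_0_iff norm_eq_zero order_less_irrefl
          split_mult_pos_le less_imp_le zero_le_power2 power_eq_0_iff)
  qed
  have "R (M x) = x" for x
    using inj[of "R (M x) - x"] MR[of "M x"] by (simp add: blinfun.diff_right)
  then show ?thesis using Rb MR by (auto simp: M)
qed

text \<open>The complex-linear operators of norm at most \<open>1\<close>.\<close>

abbreviation contractions :: "('a::complex_hilbert \<Rightarrow>\<^sub>L 'a) set"
  where "contractions \<equiv> {K \<in> bounded_ops. norm K \<le> 1}"

context hilbert_basis
begin

text \<open>
  An approximate polar decomposition: \<open>T \<approx> V |T|\<close> and \<open>V\<^sup>* T \<approx> |T|\<close>, the latter written as a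
  sesquilinear form, for the contraction \<open>V = T (|T| + \<epsilon>)\<^sup>-\<^sup>1\<close>. An error of size \<open>\<epsilon>\<close> is harmless in
  the finite sums to which it is applied, and no extension of a partial isometry is needed.
\<close>

lemma polar_approx:
  fixes T :: "'a \<Rightarrow>\<^sub>L 'a"
  assumes T: "T \<in> bounded_ops" and \<epsilon>: "\<epsilon> > 0"
  shows "\<exists>V\<in>contractions. (\<forall>x. norm (T x - V (abs_op T x)) \<le> \<epsilon> * norm x) \<and>
    (\<forall>x y. cmod (cinner (T x) (V y) - cinner (abs_op T x) y) \<le> \<epsilon> * norm x * norm y)"
proof -
  let ?P = "abs_op T"
  note P = positive_abs_op[OF T]
  obtain R where Rb: "R \<in> bounded_ops" and MR: "\<And>x. ?P (R x) + \<epsilon> *\<^sub>R R x = x"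
    and RM: "\<And>x. R (?P x + \<epsilon> *\<^sub>R x) = x"
    using positive_resolvent[OF P \<epsilon>] by blast
  define V where "V = T o\<^sub>L R"
  have PR: "norm (?P (R y)) \<le> norm y" for y
  proof -
    let ?z = "R y"
    have "cinner (?P ?z + \<epsilon> *\<^sub>R ?z) (?P ?z + \<epsilon> *\<^sub>R ?z)
        = cinner (?P ?z) (?P ?z) + of_real (2 * \<epsilon>) * cinner (?P ?z) ?z + of_real (\<epsilon>\<^sup>2) * cinner ?z ?z"
      by (simp add: cinner_simps positive_op_symmetric[OF P] scaleR_conv_of_real power2_eq_square algebra_simps)
    then have "Re (cinner y y) = Re (cinner (?P ?z) (?P ?z)) + 2 * \<epsilon> * Re (cinner (?P ?z) ?z) + \<epsilon>\<^sup>2 * Re (cinner ?z ?z)"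
      unfolding MR by simp
    then have "(norm y)\<^sup>2 = (norm (?P ?z))\<^sup>2 + 2 * \<epsilon> * Re (cinner (?P ?z) ?z) + \<epsilon>\<^sup>2 * (norm ?z)\<^sup>2"
      unfolding Re_cinner_self .
    moreover have "0 \<le> Re (cinner (?P ?z) ?z)" using P by (simp add: positive_op_def)
    ultimately have "(norm (?P ?z))\<^sup>2 \<le> (norm y)\<^sup>2" using \<epsilon> by simp
    then show ?thesis by (simp add: power2_le_iff_abs_le)
  qed
  have Vle: "norm (V y) \<le> norm y" for y
    using PR[of y] norm_abs_op_apply[OF T, of "R y"] by (simp add: V_def)
  show ?thesis
  proof (intro bexI[of _ V] conjI allI)
    show "V \<in> contractions"
      using T Rb Vle by (auto simp: V_def intro!: norm_blinfun_bound)
    fix x y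
    have "T x - V (?P x) = \<epsilon> *\<^sub>R V x"
      using arg_cong[OF RM[of x], of T]
      by (simp add: V_def blinfun.add_right blinfun.scaleR_right algebra_simps)
    then show "norm (T x - V (?P x)) \<le> \<epsilon> * norm x"
      using Vle[of x] \<epsilon> by simp
    have "cinner (T x) (V y) = cinner (?P x) (?P (R y))"
      using arg_cong[OF abs_op_square[OF T], of "\<lambda>S. S x"] positive_op_symmetric[OF P, of "?P x"]
      by (simp add: V_def cinner_adjoint'[OF T, symmetric])
    moreover have "cinner (?P x) y = cinner (?P x) (?P (R y)) + \<epsilon> *\<^sub>R cinner x (?P (R y))"
      by (subst MR[of y, symmetric]) (simp add: cinner_simps positive_op_symmetric[OF P])
    ultimately have "cmod (cinner (T x) (V y) - cinner (?P x) y) = \<epsilon> * cmod (cinner x (?P (R y)))"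
      using \<epsilon> by simp
    also have "\<dots> \<le> \<epsilon> * (norm x * norm y)"
      using norm_cinner_le[of x "?P (R y)"] mult_left_mono[OF PR[of y], of "norm x"] \<epsilon>
      by (intro mult_left_mono) auto
    finally show "cmod (cinner (T x) (V y) - cinner (?P x) y) \<le> \<epsilon> * norm x * norm y"
      by (simp add: mult.assoc)
  qed
qed

lemma adjoint_contraction: "(K :: 'a \<Rightarrow>\<^sub>L 'a) \<in> contractions \<Longrightarrow> adjoint_op K \<in> contractions"
  using norm_adjoint_le order_trans by fastforce

lemma compose_contractions: "(K :: 'a \<Rightarrow>\<^sub>L 'a) \<in> contractions \<Longrightarrow> L \<in> contractions \<Longrightarrow> K o\<^sub>L L \<in> contractions"
  using norm_blinfun_compose[of K L] mult_le_one[of "norm K" "norm L"] by auto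

lemma unitary_contraction: "unitary_op (U :: 'a \<Rightarrow>\<^sub>L 'a) \<Longrightarrow> U \<in> contractions"
  by (auto simp: unitary_op_def unitary_norm intro!: norm_blinfun_bound)

text \<open>Right multiplication by a contraction is left multiplication by one for the adjoints.\<close>

lemma sum_compose_contraction_le:
  fixes A :: "'a \<Rightarrow>\<^sub>L 'a"
  assumes A: "A \<in> bounded_ops" and sm: "summable (\<lambda>i. (norm (A (e i)))\<^sup>2)" and L: "L \<in> contractions"
  shows "(\<Sum>j<n. (norm (A (L (e j))))\<^sup>2) \<le> (\<Sum>i. (norm (A (e i)))\<^sup>2)"
proof -
  let ?B = "adjoint_op L o\<^sub>L adjoint_op A"
  have L': "adjoint_op L \<in> contractions" by (rule adjoint_contraction[OF L])
  have le: "(norm (?B (e i)))\<^sup>2 \<le> (norm (adjoint_op A (e i)))\<^sup>2" for i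
    using L' by (intro power_mono) (simp_all add: norm_blinfun_contract)
  have sA: "summable (\<lambda>i. (norm (adjoint_op A (e i)))\<^sup>2)"
    by (rule summableI_nonneg_bounded[OF _ sum_adjoint_le[OF A sm]]) simp
  have sB: "summable (\<lambda>i. (norm (?B (e i)))\<^sup>2)"
    by (rule summable_comparison_test'[OF sA, of 0]) (use le in simp)
  have Bb: "?B \<in> bounded_ops" using L A by (intro bounded_ops_compose) auto
  have "adjoint_op ?B = A o\<^sub>L L"
    using L A by (simp add: adjoint_compose adjoint_adjoint)
  then have "(\<Sum>j<n. (norm (A (L (e j))))\<^sup>2) \<le> (\<Sum>i. (norm (?B (e i)))\<^sup>2)"
    using sum_adjoint_le[OF Bb sB, of n] by simp
  also have "\<dots> \<le> (\<Sum>i. (norm (adjoint_op A (e i)))\<^sup>2)"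
    by (rule suminf_le[OF le sB sA])
  also have "\<dots> \<le> (\<Sum>i. (norm (A (e i)))\<^sup>2)"
    by (rule suminf_le_const[OF sA sum_adjoint_le[OF A sm]])
  finally show ?thesis .
qed

text \<open>
  An upper bound for the trace norm: the trace of \<open>|T|\<close> is recovered by testing with \<open>K = V\<close> from
  the approximate polar decomposition.
\<close>

lemma trace_normI:
  fixes T :: "'a \<Rightarrow>\<^sub>L 'a"
  assumes T: "T \<in> bounded_ops"
    and le: "\<And>n K. K \<in> contractions \<Longrightarrow> (\<Sum>j<n. Re (cinner (T (e j)) (K (e j)))) \<le> C"
  shows "T \<in> trace_class_ops e" and "trace_norm e T \<le> C"
proof -
  let ?P = "abs_op T"
  note P = positive_abs_op[OF T]
  have bound: "(\<Sum>j<n. Re (cinner (?P (e j)) (e j))) \<le> C" for n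
  proof (rule field_le_epsilon)
    fix \<delta> :: real assume "\<delta> > 0"
    define \<epsilon> where "\<epsilon> = \<delta> / (real n + 1)"
    have \<epsilon>: "\<epsilon> > 0" using \<open>\<delta> > 0\<close> by (simp add: \<epsilon>_def)
    obtain V where V: "V \<in> contractions"
      and Vc: "\<And>x y. cmod (cinner (T x) (V y) - cinner (?P x) y) \<le> \<epsilon> * norm x * norm y"
      using polar_approx[OF T \<epsilon>] by blast
    have "Re (cinner (?P (e j)) (e j)) \<le> Re (cinner (T (e j)) (V (e j))) + \<epsilon>" for j
      using Vc[of "e j" "e j"] abs_Re_le_cmod[of "cinner (T (e j)) (V (e j)) - cinner (?P (e j)) (e j)"]
      by simp
    then have "(\<Sum>j<n. Re (cinner (?P (e j)) (e j))) \<le> (\<Sum>j<n. Re (cinner (T (e j)) (V (e j))) + \<epsilon>)"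
      by (rule sum_mono)
    also have "\<dots> = (\<Sum>j<n. Re (cinner (T (e j)) (V (e j)))) + real n * \<epsilon>"
      by (simp add: sum.distrib)
    also have "\<dots> \<le> C + \<delta>"
      using le[OF V, of n] \<open>\<delta> > 0\<close> by (intro add_mono) (simp_all add: \<epsilon>_def field_simps)
    finally show "(\<Sum>j<n. Re (cinner (?P (e j)) (e j))) \<le> C + \<delta>" .
  qed
  have sm: "summable (\<lambda>j. Re (cinner (?P (e j)) (e j)))"
    using P bound by (intro summableI_nonneg_bounded) (auto simp: positive_op_def)
  then show "T \<in> trace_class_ops e" using T by (simp add: trace_class_ops_def)
  show "trace_norm e T \<le> C"
    unfolding trace_norm_def by (rule suminf_le_const[OF sm bound])
qed

text \<open>
  A trace class operator is nearly a product of two Hilbert--Schmidt operators: with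
  \<open>Q = |T|\<^sup>1\<^sup>/\<^sup>2\<close>, \<open>\<langle>T M L e\<^sub>j, K e\<^sub>j\<rangle> \<approx> \<langle>Q M L e\<^sub>j, Q V\<^sup>* K e\<^sub>j\<rangle>\<close>, and the sum over \<open>j\<close> is bounded by
  the Cauchy--Schwarz inequality. The factor \<open>M\<close> allows small tails, \<open>M = 1 - P\<^sub>m\<close>.
\<close>

lemma trace_class_factor:
  fixes T :: "'a \<Rightarrow>\<^sub>L 'a"
  assumes T: "T \<in> trace_class_ops e"
  shows "\<exists>Q\<in>bounded_ops. (\<lambda>i. (norm (Q (e i)))\<^sup>2) sums trace_norm e T \<and>
    (\<forall>n M L K. M \<in> bounded_ops \<longrightarrow> summable (\<lambda>i. (norm (Q (M (e i))))\<^sup>2) \<longrightarrow>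
      L \<in> contractions \<longrightarrow> K \<in> contractions \<longrightarrow>
      (\<Sum>j<n. Re (cinner (T (M (blinfun_apply L (e j)))) (blinfun_apply K (e j))))
        \<le> sqrt (\<Sum>i. (norm (Q (M (e i))))\<^sup>2) * sqrt (trace_norm e T))"
proof -
  let ?P = "abs_op T"
  have Tb: "T \<in> bounded_ops" and Tsm: "summable (\<lambda>j. Re (cinner (?P (e j)) (e j)))"
    using T by (auto simp: trace_class_ops_def)
  obtain Q where Q: "positive_op Q" and QQ: "Q o\<^sub>L Q = ?P"
    using positive_sqrt_ex1[OF positive_abs_op[OF Tb]] by blast
  have Qb: "Q \<in> bounded_ops" using Q by (simp add: positive_op_def)
  have QQx: "?P x = Q (Q x)" for x using arg_cong[OF QQ, of "\<lambda>S. S x"] by simp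
  have nQ: "(norm (Q x))\<^sup>2 = Re (cinner (?P x) x)" for x
    by (simp add: QQx positive_op_symmetric[OF Q, of "Q x"] cinner_self)
  have sums: "(\<lambda>i. (norm (Q (e i)))\<^sup>2) sums trace_norm e T"
    unfolding nQ trace_norm_def by (rule summable_sums[OF Tsm])
  show ?thesis
  proof (intro bexI[OF _ Qb] conjI[OF sums] allI impI)
    fix n M and L K :: "'a \<Rightarrow>\<^sub>L 'a"
    assume M: "M \<in> bounded_ops" and sm: "summable (\<lambda>i. (norm (Q (M (e i))))\<^sup>2)"
      and L: "L \<in> contractions" and K: "K \<in> contractions"
    let ?S = "sqrt (\<Sum>i. (norm (Q (M (e i))))\<^sup>2)"
    show "(\<Sum>j<n. Re (cinner (T (M (L (e j)))) (K (e j)))) \<le> ?S * sqrt (trace_norm e T)"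
    proof (rule field_le_epsilon)
      fix \<delta> :: real assume "\<delta> > 0"
      define \<epsilon> where "\<epsilon> = \<delta> / ((real n + 1) * (norm M + 1))"
      have pos: "(real n + 1) * (norm M + 1) > 0"
        by (intro mult_pos_pos) (simp_all add: add_nonneg_pos)
      then have \<epsilon>: "\<epsilon> > 0" using \<open>\<delta> > 0\<close> by (simp add: \<epsilon>_def)
      obtain V where V: "V \<in> contractions"
        and Vc: "\<And>x. norm (T x - V (?P x)) \<le> \<epsilon> * norm x"
        using polar_approx[OF Tb \<epsilon>] by blast
      define x where "x j = M (L (e j))" for j
      define G where "G = adjoint_op V o\<^sub>L K"
      have G: "G \<in> contractions"
        unfolding G_def by (intro compose_contractions adjoint_contraction V K)
      have "Re (cinner (T (x j)) (K (e j))) \<le> norm (Q (x j)) * norm (Q (G (e j))) + \<epsilon> * norm M" for j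
      proof -
        have xj: "norm (x j) \<le> norm M"
          unfolding x_def using norm_blinfun[of M "L (e j)"] norm_blinfun_contract[of L "e j"] L
            mult_left_mono[of "norm (L (e j))" 1 "norm M"] by simp
        have Kj: "norm (K (e j)) \<le> 1" using norm_blinfun_contract[of K "e j"] K by simp
        have "cinner (T (x j)) (K (e j)) = cinner (T (x j) - V (?P (x j))) (K (e j)) + cinner (V (?P (x j))) (K (e j))"
          by (simp add: cinner_simps)
        moreover have "cinner (V (?P (x j))) (K (e j)) = cinner (Q (x j)) (Q (G (e j)))"
          using V by (simp add: QQx G_def cinner_adjoint positive_op_symmetric[OF Q, of "Q (x j)"])
        ultimately have "Re (cinner (T (x j)) (K (e j)))
            = Re (cinner (T (x j) - V (?P (x j))) (K (e j))) + Re (cinner (Q (x j)) (Q (G (e j))))"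
          by simp
        also have "\<dots> \<le> norm (T (x j) - V (?P (x j))) * norm (K (e j)) + norm (Q (x j)) * norm (Q (G (e j)))"
          by (intro add_mono order_trans[OF complex_Re_le_cmod norm_cinner_le])
        also have "norm (T (x j) - V (?P (x j))) * norm (K (e j)) \<le> (\<epsilon> * norm M) * 1"
          using order_trans[OF Vc[of "x j"] mult_left_mono[OF xj, of \<epsilon>]] \<epsilon> Kj
          by (intro mult_mono) auto
        finally show ?thesis by simp
      qed
      then have "(\<Sum>j<n. Re (cinner (T (x j)) (K (e j))))
          \<le> (\<Sum>j<n. norm (Q (x j)) * norm (Q (G (e j))) + \<epsilon> * norm M)"
        by (rule sum_mono)
      also have "\<dots> = (\<Sum>j<n. norm (Q (x j)) * norm (Q (G (e j)))) + real n * (\<epsilon> * norm M)"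
        by (simp add: sum.distrib)
      also have "(\<Sum>j<n. norm (Q (x j)) * norm (Q (G (e j))))
          \<le> L2_set (\<lambda>j. norm (Q (x j))) {..<n} * L2_set (\<lambda>j. norm (Q (G (e j)))) {..<n}"
        using L2_set_mult_ineq[of "\<lambda>j. norm (Q (x j))" "\<lambda>j. norm (Q (G (e j)))" "{..<n}"] by simp
      also have "\<dots> \<le> ?S * sqrt (trace_norm e T)"
      proof (intro mult_mono)
        show "L2_set (\<lambda>j. norm (Q (x j))) {..<n} \<le> ?S"
          using sum_compose_contraction_le[of "Q o\<^sub>L M" L n] Qb M sm L
          by (auto simp: L2_set_def x_def)
        show "L2_set (\<lambda>j. norm (Q (G (e j)))) {..<n} \<le> sqrt (trace_norm e T)"
          using sum_compose_contraction_le[OF Qb sums_summable[OF sums] G, of n] sums_unique[OF sums]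
          by (simp add: L2_set_def)
      qed (use sm in \<open>auto simp: L2_set_nonneg intro: suminf_nonneg\<close>)
      also have "real n * (\<epsilon> * norm M) \<le> \<delta>"
      proof -
        have "real n * norm M \<le> (real n + 1) * (norm M + 1)" by (intro mult_mono) auto
        then have "\<epsilon> * (real n * norm M) \<le> \<epsilon> * ((real n + 1) * (norm M + 1))"
          using \<epsilon> by (intro mult_left_mono) auto
        also have "\<dots> = \<delta>"
          using nonzero_eq_divide_eq[OF less_imp_neq[OF pos, symmetric]] \<epsilon>_def by blast
        finally show ?thesis by (simp add: mult_ac)
      qed
      finally show "(\<Sum>j<n. Re (cinner (T (M (L (e j)))) (K (e j)))) \<le> ?S * sqrt (trace_norm e T) + \<delta>"
        by (simp add: x_def)
    qed
  qed
qed

lemma id_contraction: "id_blinfun \<in> (contractions :: ('a \<Rightarrow>\<^sub>L 'a) set)"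
  using norm_blinfun_id_le by simp

lemma trace_norm_ge:
  fixes T :: "'a \<Rightarrow>\<^sub>L 'a"
  assumes T: "T \<in> trace_class_ops e" and L: "L \<in> contractions" and K: "K \<in> contractions"
  shows "(\<Sum>j<n. Re (cinner (T (L (e j))) (K (e j)))) \<le> trace_norm e T"
proof -
  obtain Q :: "'a \<Rightarrow>\<^sub>L 'a" where Q: "(\<lambda>i. (norm (Q (e i)))\<^sup>2) sums trace_norm e T"
    and le: "\<forall>n M L K. M \<in> bounded_ops \<longrightarrow> summable (\<lambda>i. (norm (Q (M (e i))))\<^sup>2) \<longrightarrow>
      L \<in> contractions \<longrightarrow> K \<in> contractions \<longrightarrow>
      (\<Sum>j<n. Re (cinner (T (M (blinfun_apply L (e j)))) (blinfun_apply K (e j))))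
        \<le> sqrt (\<Sum>i. (norm (Q (M (e i))))\<^sup>2) * sqrt (trace_norm e T)"
    using trace_class_factor[OF T] by blast
  have "0 \<le> trace_norm e T" using sums_le[OF _ sums_zero Q] by simp
  then show ?thesis
    using le[rule_format, of id_blinfun L K n] L K sums_summable[OF Q] sums_unique[OF Q, symmetric]
    by simp
qed

end

section \<open>Transfer of the criterion between vectors and operators\<close>

text \<open>Powers of an operator as operators, so that they can be composed with others.\<close>

definition op_pow :: "('a::complex_hilbert \<Rightarrow>\<^sub>L 'a) \<Rightarrow> nat \<Rightarrow> ('a \<Rightarrow>\<^sub>L 'a)"
  where "op_pow T n = ((o\<^sub>L) T ^^ n) id_blinfun"

lemma op_pow_apply: "op_pow T n x = (blinfun_apply T ^^ n) x"
  by (induction n arbitrary: x) (simp_all add: op_pow_def)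

lemma op_pow_bounded_ops: "T \<in> bounded_ops \<Longrightarrow> op_pow T n \<in> bounded_ops"
  by (induction n) (auto simp: op_pow_def)

lemma funpow_mult_op: "(mult_op U W ^^ n) F = op_pow W n o\<^sub>L F o\<^sub>L op_pow U n"
proof (induction n)
  case (Suc n)
  have step: "(mult_op U W ^^ Suc n) F = mult_op U W (op_pow W n o\<^sub>L F o\<^sub>L op_pow U n)"
    using Suc by simp
  show ?case
    unfolding step by (rule blinfun_eqI) (simp add: mult_op_def op_pow_apply funpow_swap1)
qed (simp add: op_pow_def blinfun_eqI)

lemma op_pow_contraction:
  assumes "U \<in> contractions"
  shows "op_pow U n \<in> contractions"
proof (induction n)
  case (Suc n)
  then show ?case
    using assms norm_blinfun_compose[of U "op_pow U n"] mult_le_one[of "norm U" "norm (op_pow U n)"]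
    by (auto simp: op_pow_def)
qed (simp add: op_pow_def norm_blinfun_id_le)

lemma op_pow_inverse:
  fixes U V :: "'a::complex_hilbert \<Rightarrow>\<^sub>L 'a"
  assumes "\<And>x. V (U x) = x"
  shows "op_pow V n (op_pow U n x) = x"
  by (induction n arbitrary: x) (simp_all add: op_pow_apply funpow_swap1 assms)

lemma d_hypercyclicity_criterionE:
  assumes "d_hypercyclicity_criterion X nrm N T"
  obtains n :: "nat \<Rightarrow> nat" and D V where "strict_mono n"
    and "\<forall>l\<in>{0..N}. dense_in X nrm (D l)"
    and "\<forall>l\<in>{1..N}. \<forall>k. V l k ` D l \<subseteq> X"
    and "\<forall>l\<in>{1..N}. \<forall>x\<in>D 0. (\<lambda>k. nrm ((T l ^^ n k) x)) \<longlonglongrightarrow> 0"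
    and "\<forall>l\<in>{1..N}. \<forall>x\<in>D l. (\<lambda>k. nrm (V l k x)) \<longlonglongrightarrow> 0"
    and "\<forall>l\<in>{1..N}. \<forall>s\<in>{1..N}. s \<noteq> l \<longrightarrow> (\<forall>x\<in>D s.
      (\<lambda>k. nrm ((T l ^^ n k) (V s k x))) \<longlonglongrightarrow> 0)"
    and "\<forall>l\<in>{1..N}. \<forall>x\<in>D l.
      (\<lambda>k. nrm ((T l ^^ n k) (V l k x) - x)) \<longlonglongrightarrow> 0"
  using assms unfolding d_hypercyclicity_criterion_def by (elim conjE exE) (rule that; assumption)

text \<open>
  A normed ideal of operators (with respect to multiplication by unitary operators on the right)
  in which the finite-rank operators vanishing on all but finitely
  many basis vectors are dense.
\<close>

locale operator_ideal = hilbert_basis e for e :: "nat \<Rightarrow> 'a::complex_hilbert" +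
  fixes B :: "('a \<Rightarrow>\<^sub>L 'a) set" and nrm :: "('a \<Rightarrow>\<^sub>L 'a) \<Rightarrow> real"
  assumes ideal_add: "F \<in> B \<Longrightarrow> G \<in> B \<Longrightarrow> F + G \<in> B"
    and ideal_compose: "F \<in> B \<Longrightarrow> W \<in> bounded_ops \<Longrightarrow> unitary_op U \<Longrightarrow> W o\<^sub>L F o\<^sub>L U \<in> B"
    and ideal_rank_one: "rank_one x y \<in> B"
    and norm_le_nrm: "F \<in> B \<Longrightarrow> norm F \<le> nrm F"
    and nrm_triangle: "F \<in> B \<Longrightarrow> G \<in> B \<Longrightarrow> nrm (F + G) \<le> nrm F + nrm G"
    and nrm_rank_one: "nrm (rank_one x y) \<le> norm x * norm y"
    and nrm_approx: "F \<in> B \<Longrightarrow> \<epsilon> > 0 \<Longrightarrow> \<exists>m. \<exists>A\<in>bounded_ops. nrm (F - (A o\<^sub>L proj m)) < \<epsilon>"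
begin

lemma nrm_ge_0: "F \<in> B \<Longrightarrow> 0 \<le> nrm F"
  using norm_le_nrm[of F] norm_ge_zero[of F] by linarith

lemma unitary_id: "unitary_op (id_blinfun :: 'a \<Rightarrow>\<^sub>L 'a)"
proof -
  have "adjoint_op (id_blinfun :: 'a \<Rightarrow>\<^sub>L 'a) = id_blinfun"
    by (rule adjoint_eqI) auto
  then show ?thesis by (simp add: unitary_op_def blinfun_eqI)
qed

lemma ideal_uminus: "F \<in> B \<Longrightarrow> - F \<in> B"
  using ideal_compose[of F "(- 1) *\<^sub>R id_blinfun" id_blinfun] unitary_id
  by (simp add: bounded_ops_scaleR[OF bounded_ops_id, of "- 1", simplified])
     (metis (no_types, lifting) blinfun_apply_blinfun_compose blinfun_eqI id_blinfun.rep_eq uminus_blinfun.rep_eq)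

lemma ideal_diff: "F \<in> B \<Longrightarrow> G \<in> B \<Longrightarrow> F - G \<in> B"
  using ideal_add[of F "- G"] ideal_uminus[of G] by simp

lemma rank_one_zero: "rank_one 0 0 = 0"
  by (rule blinfun_eqI) (simp add: rank_one_apply)

lemma ideal_zero: "0 \<in> B"
  using ideal_rank_one[of 0 0] by (simp add: rank_one_zero)

lemma nrm_zero: "nrm 0 = 0"
  using nrm_rank_one[of 0 0] nrm_ge_0[OF ideal_zero] by (simp add: rank_one_zero)

lemma
  assumes "finite S"
  shows ideal_sum_rank_one: "(\<Sum>j\<in>S. rank_one (x j) (y j)) \<in> B"
    and nrm_sum_rank_one: "nrm (\<Sum>j\<in>S. rank_one (x j) (y j)) \<le> (\<Sum>j\<in>S. norm (x j) * norm (y j))"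
proof -
  have "(\<Sum>j\<in>S. rank_one (x j) (y j)) \<in> B \<and>
    nrm (\<Sum>j\<in>S. rank_one (x j) (y j)) \<le> (\<Sum>j\<in>S. norm (x j) * norm (y j))"
    using assms
  proof induction
    case (insert i S)
    then show ?case
      using ideal_add[OF ideal_rank_one[of "x i" "y i"]] nrm_rank_one[of "x i" "y i"]
        nrm_triangle[OF ideal_rank_one[of "x i" "y i"], of "\<Sum>j\<in>S. rank_one (x j) (y j)"]
      by auto
  qed (simp add: ideal_zero nrm_zero)
  then show "(\<Sum>j\<in>S. rank_one (x j) (y j)) \<in> B"
    "nrm (\<Sum>j\<in>S. rank_one (x j) (y j)) \<le> (\<Sum>j\<in>S. norm (x j) * norm (y j))" by auto
qed

text \<open>The operator with \<open>e j \<mapsto> x j\<close> for \<open>j < m\<close> that vanishes on the other basis vectors.\<close>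

definition fin_op :: "nat \<Rightarrow> (nat \<Rightarrow> 'a) \<Rightarrow> ('a \<Rightarrow>\<^sub>L 'a)"
  where "fin_op m x = (\<Sum>j<m. rank_one (x j) (e j))"

lemma fin_op_compose:
  assumes "C \<in> bounded_ops"
  shows "fin_op m x o\<^sub>L C = (\<Sum>j<m. rank_one (x j) (adjoint_op C (e j)))"
  using assms
  by (simp add: fin_op_def bounded_bilinear.sum_left[OF bounded_bilinear_blinfun_compose] rank_one_compose)

lemma compose_fin_op: "A \<in> bounded_ops \<Longrightarrow> A o\<^sub>L fin_op m x = fin_op m (\<lambda>j. A (x j))"
  by (simp add: fin_op_def bounded_bilinear.sum_right[OF bounded_bilinear_blinfun_compose] compose_rank_one)

lemma fin_op_diff: "fin_op m x - fin_op m y = fin_op m (\<lambda>j. x j - y j)"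
  by (simp add: fin_op_def rank_one_diff_left sum_subtractf[symmetric])

lemma fin_op_in_ideal: "C \<in> bounded_ops \<Longrightarrow> fin_op m x o\<^sub>L C \<in> B"
  by (simp add: fin_op_compose ideal_sum_rank_one)

lemma compose_id [simp]: "(F :: 'a \<Rightarrow>\<^sub>L 'a) o\<^sub>L id_blinfun = F"
  by (rule blinfun_eqI) simp

lemma fin_op_in_ideal': "fin_op m x \<in> B"
  using fin_op_in_ideal[of id_blinfun m x] by simp

lemma nrm_fin_op_le:
  assumes "C \<in> contractions"
  shows "nrm (fin_op m x o\<^sub>L C) \<le> (\<Sum>j<m. norm (x j))"
proof -
  have C': "norm (adjoint_op C (e j)) \<le> 1" for j
    using norm_blinfun_contract[of "adjoint_op C" "e j"] adjoint_contraction[OF assms] by simp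
  have "nrm (fin_op m x o\<^sub>L C) \<le> (\<Sum>j<m. norm (x j) * norm (adjoint_op C (e j)))"
    using assms by (simp add: fin_op_compose nrm_sum_rank_one)
  also have "\<dots> \<le> (\<Sum>j<m. norm (x j))"
    by (intro sum_mono mult_left_le C') simp
  finally show ?thesis .
qed

lemma nrm_fin_op_tendsto_0:
  assumes "\<And>k. C k \<in> contractions" and "\<And>j. j < m \<Longrightarrow> (\<lambda>k. norm (x k j)) \<longlonglongrightarrow> 0"
  shows "(\<lambda>k. nrm (fin_op m (x k) o\<^sub>L C k)) \<longlonglongrightarrow> 0"
proof (rule tendsto_sandwich[OF _ _ tendsto_const])
  show "\<forall>\<^sub>F k in sequentially. 0 \<le> nrm (fin_op m (x k) o\<^sub>L C k)"
    using assms(1) by (intro always_eventually allI nrm_ge_0 fin_op_in_ideal) auto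
  show "\<forall>\<^sub>F k in sequentially. nrm (fin_op m (x k) o\<^sub>L C k) \<le> (\<Sum>j<m. norm (x k j))"
    by (intro always_eventually allI nrm_fin_op_le assms)
  show "(\<lambda>k. \<Sum>j<m. norm (x k j)) \<longlonglongrightarrow> 0"
    by (rule tendsto_null_sum) (use assms(2) in auto)
qed

lemma fin_ops_dense:
  assumes D: "dense_in UNIV norm D"
  shows "dense_in B nrm {fin_op m x | m x. \<forall>j<m. x j \<in> D}"
  unfolding dense_in_def
proof (intro conjI ballI allI impI)
  show "{fin_op m x | m x. \<forall>j<m. x j \<in> D} \<subseteq> B" using fin_op_in_ideal' by auto
  fix F and \<epsilon> :: real assume F: "F \<in> B" and \<epsilon>: "\<epsilon> > 0"
  obtain m A where A: "A \<in> bounded_ops" and FA: "nrm (F - (A o\<^sub>L proj m)) < \<epsilon> / 2"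
    using nrm_approx[OF F, of "\<epsilon> / 2"] \<epsilon> by auto
  have "\<exists>d\<in>D. norm (A (e j) - d) < \<epsilon> / (2 * (real m + 1))" for j
    using D \<epsilon> by (auto simp: dense_in_def)
  then obtain x where x: "\<And>j. x j \<in> D" "\<And>j. norm (A (e j) - x j) < \<epsilon> / (2 * (real m + 1))"
    by metis
  have AP: "A o\<^sub>L proj m = fin_op m (\<lambda>j. A (e j))"
    using A by (simp add: compose_proj fin_op_def)
  have "nrm (fin_op m (\<lambda>j. A (e j) - x j)) \<le> (\<Sum>j<m. norm (A (e j) - x j))"
    using nrm_fin_op_le[OF id_contraction, of m "\<lambda>j. A (e j) - x j"] by simp
  also have "\<dots> \<le> (\<Sum>j<m. \<epsilon> / (2 * (real m + 1)))"
    by (intro sum_mono less_imp_le x)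
  also have "\<dots> \<le> \<epsilon> / 2" using \<epsilon> by (simp add: field_simps)
  finally have small: "nrm (fin_op m (\<lambda>j. A (e j) - x j)) \<le> \<epsilon> / 2" .
  have split: "F - fin_op m x = (F - (A o\<^sub>L proj m)) + fin_op m (\<lambda>j. A (e j) - x j)"
    by (simp add: AP fin_op_diff[symmetric])
  have "nrm (F - fin_op m x) \<le> nrm (F - (A o\<^sub>L proj m)) + nrm (fin_op m (\<lambda>j. A (e j) - x j))"
    unfolding split by (intro nrm_triangle ideal_diff F fin_op_in_ideal') (simp add: AP fin_op_in_ideal')
  then have "nrm (F - fin_op m x) < \<epsilon>" using FA small by simp
  then show "\<exists>d\<in>{fin_op m x | m x. \<forall>j<m. x j \<in> D}. nrm (F - d) < \<epsilon>" using x(1) by blast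
qed

lemma ideal_funpow_mult_op:
  assumes "F \<in> B" and W: "W \<in> bounded_ops" and U: "unitary_op U"
  shows "(mult_op U W ^^ n) F \<in> B"
  by (induction n) (auto simp: mult_op_def assms ideal_compose)

text \<open>
  The powers of \<open>U\<close> drop out: from vectors to operators they are cancelled by powers of \<open>U\<^sup>*\<close> in the
  new maps, from operators to vectors they act as isometries.
\<close>

lemma criterion_operators_iff:
  assumes U: "unitary_op U" and W: "\<forall>l\<in>{1..N}. W l \<in> bounded_ops"
  shows "d_hypercyclicity_criterion B nrm N (\<lambda>l. mult_op U (W l) ^^ r l) \<longleftrightarrow>
    d_hypercyclicity_criterion UNIV norm N (\<lambda>l. blinfun_apply (W l) ^^ r l)"
    (is "?crit_B \<longleftrightarrow> ?crit_H")
proof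
  let ?U' = "adjoint_op U"
  have Uc: "U \<in> contractions" by (rule unitary_contraction[OF U])
  have U'c: "?U' \<in> contractions" by (rule adjoint_contraction[OF Uc])
  have UU': "op_pow U n (op_pow ?U' n x) = x" and U'U: "op_pow ?U' n (op_pow U n x) = x" for n x
  proof -
    have "?U' (U x) = x" "U (?U' x) = x" for x
      using U unfolding unitary_op_def by (metis blinfun_apply_blinfun_compose id_blinfun.rep_eq)+
    then show "op_pow U n (op_pow ?U' n x) = x" "op_pow ?U' n (op_pow U n x) = x"
      by (simp_all add: op_pow_inverse)
  qed
  have range_B: "(mult_op U (W l) ^^ r l) ` B \<subseteq> B" if "l \<in> {1..N}" for l
    using ideal_funpow_mult_op W U that by auto
  have pow_B: "((mult_op U (W l) ^^ r l) ^^ n) F = op_pow (W l) (r l * n) o\<^sub>L F o\<^sub>L op_pow U (r l * n)" for l n F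
    by (simp only: funpow_mult funpow_mult_op)
  have pow_H: "((blinfun_apply (W l) ^^ r l) ^^ n) x = op_pow (W l) (r l * n) x" for l n x
    by (simp only: funpow_mult op_pow_apply)
  {
    assume ?crit_H
    then obtain n :: "nat \<Rightarrow> nat" and D V where n: "strict_mono n"
        and D: "\<forall>l\<in>{0..N}. dense_in UNIV norm (D l)"
        and "\<forall>l\<in>{1..N}. \<forall>k. V l k ` D l \<subseteq> UNIV"
        and D0: "\<forall>l\<in>{1..N}. \<forall>x\<in>D 0.
          (\<lambda>k. norm (((blinfun_apply (W l) ^^ r l) ^^ n k) x)) \<longlonglongrightarrow> 0"
        and V: "\<forall>l\<in>{1..N}. \<forall>x\<in>D l. (\<lambda>k. norm (V l k x)) \<longlonglongrightarrow> 0"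
        and VW: "\<forall>l\<in>{1..N}. \<forall>s\<in>{1..N}. s \<noteq> l \<longrightarrow> (\<forall>x\<in>D s.
          (\<lambda>k. norm (((blinfun_apply (W l) ^^ r l) ^^ n k) (V s k x))) \<longlonglongrightarrow> 0)"
        and Vid: "\<forall>l\<in>{1..N}. \<forall>x\<in>D l.
          (\<lambda>k. norm (((blinfun_apply (W l) ^^ r l) ^^ n k) (V l k x) - x)) \<longlonglongrightarrow> 0"
      by (rule d_hypercyclicity_criterionE) (rule that; assumption)
    note D = D[rule_format] and V = V[rule_format] and D0 = D0[unfolded pow_H, rule_format]
      and VW = VW[unfolded pow_H, rule_format] and Vid = Vid[unfolded pow_H, rule_format]
    \<comment> \<open>a member of \<open>E l\<close> may have several representations; fix one of them for each\<close>
    define E where "E l = {fin_op m x | m x. \<forall>j<m. x j \<in> D l}" for l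
    have "\<forall>l. \<forall>F\<in>E l. \<exists>p. F = fin_op (fst p) (snd p) \<and> (\<forall>j<fst p. snd p j \<in> D l)"
      by (auto simp: E_def)
    then obtain p where p: "\<And>l F. F \<in> E l \<Longrightarrow> F = fin_op (fst (p l F)) (snd (p l F))"
        "\<And>l F j. F \<in> E l \<Longrightarrow> j < fst (p l F) \<Longrightarrow> snd (p l F) j \<in> D l"
      by metis
    define m where "m l F = fst (p l F)" for l F
    define X where "X l F = snd (p l F)" for l F
    have F_eq: "F = fin_op (m l F) (X l F)" if "F \<in> E l" for l F
      using p that by (simp add: m_def X_def)
    have X_in: "X l F j \<in> D l" if "F \<in> E l" "j < m l F" for l F j
      using p that by (simp add: m_def X_def)
    define V' where "V' l k F = fin_op (m l F) (\<lambda>j. V l k (X l F j)) o\<^sub>L op_pow ?U' (r l * n k)" for l k F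
    have step: "op_pow (W l) i o\<^sub>L (fin_op q x o\<^sub>L C) o\<^sub>L op_pow U i
        = fin_op q (\<lambda>j. op_pow (W l) i (x j)) o\<^sub>L (C o\<^sub>L op_pow U i)"
      if "l \<in> {1..N}" for l i q x C
      by (subst compose_fin_op[symmetric]) (use that W in \<open>auto intro!: op_pow_bounded_ops blinfun_eqI\<close>)
    show ?crit_B
      unfolding d_hypercyclicity_criterion_def pow_B
    proof (intro conjI exI[of _ n] exI[of _ E] exI[of _ V'] ballI allI impI)
      show "strict_mono n" by (rule n)
      show "(mult_op U (W l) ^^ r l) ` B \<subseteq> B" if "l \<in> {1..N}" for l by (rule range_B[OF that])
      show "dense_in B nrm (E l)" if "l \<in> {0..N}" for l
        unfolding E_def by (rule fin_ops_dense[OF D[OF that]])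
      show "V' l k ` E l \<subseteq> B" for l k
        using op_pow_contraction[OF U'c] by (auto simp: V'_def intro!: fin_op_in_ideal)
      show "(\<lambda>k. nrm (op_pow (W l) (r l * n k) o\<^sub>L F o\<^sub>L op_pow U (r l * n k))) \<longlonglongrightarrow> 0"
        if l: "l \<in> {1..N}" and F: "F \<in> E 0" for l F
      proof -
        have "(\<lambda>k. nrm (fin_op (m 0 F) (\<lambda>j. op_pow (W l) (r l * n k) (X 0 F j)) o\<^sub>L
            (id_blinfun o\<^sub>L op_pow U (r l * n k)))) \<longlonglongrightarrow> 0"
          by (intro nrm_fin_op_tendsto_0 compose_contractions id_contraction op_pow_contraction Uc
              D0 l X_in F)
        then show ?thesis by (simp only: step[OF l, symmetric] compose_id F_eq[OF F, symmetric])
      qed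
      show "(\<lambda>k. nrm (V' l k F)) \<longlonglongrightarrow> 0" if l: "l \<in> {1..N}" and F: "F \<in> E l" for l F
        unfolding V'_def by (intro nrm_fin_op_tendsto_0 op_pow_contraction U'c V l X_in F)
      show "(\<lambda>k. nrm (op_pow (W l) (r l * n k) o\<^sub>L V' s k F o\<^sub>L op_pow U (r l * n k))) \<longlonglongrightarrow> 0"
        if l: "l \<in> {1..N}" and s: "s \<in> {1..N}" "s \<noteq> l" and F: "F \<in> E s" for l s F
        unfolding V'_def step[OF l]
        by (intro nrm_fin_op_tendsto_0 compose_contractions op_pow_contraction Uc U'c VW l s X_in F)
      show "(\<lambda>k. nrm ((op_pow (W l) (r l * n k) o\<^sub>L V' l k F o\<^sub>L op_pow U (r l * n k)) - F)) \<longlonglongrightarrow> 0"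
        if l: "l \<in> {1..N}" and F: "F \<in> E l" for l F
      proof -
        have U'U_id: "op_pow ?U' i o\<^sub>L op_pow U i = id_blinfun" for i
          by (rule blinfun_eqI) (simp add: U'U)
        have "(\<lambda>k. nrm (fin_op (m l F) (\<lambda>j. op_pow (W l) (r l * n k) (V l k (X l F j)) - X l F j)
            o\<^sub>L id_blinfun)) \<longlonglongrightarrow> 0"
          by (intro nrm_fin_op_tendsto_0 id_contraction Vid l X_in F)
        then show ?thesis
          by (simp only: V'_def step[OF l] U'U_id compose_id fin_op_diff[symmetric] F_eq[OF F, symmetric])
      qed
    qed
  }
  {
    assume ?crit_B
    then obtain n :: "nat \<Rightarrow> nat" and D V where n: "strict_mono n"
        and D: "\<forall>l\<in>{0..N}. dense_in B nrm (D l)"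
        and VB: "\<forall>l\<in>{1..N}. \<forall>k. V l k ` D l \<subseteq> B"
        and D0: "\<forall>l\<in>{1..N}. \<forall>F\<in>D 0.
          (\<lambda>k. nrm (((mult_op U (W l) ^^ r l) ^^ n k) F)) \<longlonglongrightarrow> 0"
        and V: "\<forall>l\<in>{1..N}. \<forall>F\<in>D l. (\<lambda>k. nrm (V l k F)) \<longlonglongrightarrow> 0"
        and VW: "\<forall>l\<in>{1..N}. \<forall>s\<in>{1..N}. s \<noteq> l \<longrightarrow> (\<forall>F\<in>D s.
          (\<lambda>k. nrm (((mult_op U (W l) ^^ r l) ^^ n k) (V s k F))) \<longlonglongrightarrow> 0)"
        and Vid: "\<forall>l\<in>{1..N}. \<forall>F\<in>D l.
          (\<lambda>k. nrm (((mult_op U (W l) ^^ r l) ^^ n k) (V l k F) - F)) \<longlonglongrightarrow> 0"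
      by (rule d_hypercyclicity_criterionE) (rule that; assumption)
    note D = D[rule_format] and V = V[rule_format] and D0 = D0[unfolded pow_B, rule_format]
      and VW = VW[unfolded pow_B, rule_format] and Vid = Vid[unfolded pow_B, rule_format] and VB = VB[rule_format]
    \<comment> \<open>evaluate at \<open>e 0\<close>, choosing one operator \<open>\<Phi> l x\<close> over each value \<open>x\<close>\<close>
    define E where "E l = (\<lambda>F. blinfun_apply F (e 0)) ` D l" for l
    define \<Phi> where "\<Phi> l x = inv_into (D l) (\<lambda>F. blinfun_apply F (e 0)) x" for l x
    have \<Phi>_in: "\<Phi> l x \<in> D l" and \<Phi>_eq: "\<Phi> l x (e 0) = x" if "x \<in> E l" for l x
      using inv_into_into[of x "\<lambda>F. blinfun_apply F (e 0)" "D l"]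
        f_inv_into_f[of x "\<lambda>F. blinfun_apply F (e 0)" "D l"] that
      unfolding E_def \<Phi>_def by blast+
    define V' where "V' l k x = V l k (\<Phi> l x) (op_pow U (r l * n k) (e 0))" for l k x
    have DB: "F \<in> B" if "F \<in> D l" "l \<in> {0..N}" for F l
      using D[OF that(2)] that(1) by (auto simp: dense_in_def)
    have VinB: "V l k (\<Phi> l x) \<in> B" if "x \<in> E l" "l \<in> {1..N}" for l k x
      using VB[OF that(2), of k] \<Phi>_in[OF that(1)] by auto
    have WFU_B: "op_pow (W l) i o\<^sub>L F o\<^sub>L op_pow U i \<in> B" if "F \<in> B" "l \<in> {1..N}" for l i F
      using ideal_funpow_mult_op[OF that(1) _ U, of "W l" i] W that(2) by (simp add: funpow_mult_op)
    have app_le: "norm (F x) \<le> nrm F" if "F \<in> B" "norm x \<le> 1" for F x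
      using norm_blinfun[of F x] norm_le_nrm[OF that(1)] mult_left_mono[OF that(2), of "norm F"] by simp
    have pU_le: "norm (op_pow U i (e 0)) \<le> 1" "norm (op_pow ?U' i (e 0)) \<le> 1" for i
      using norm_blinfun_contract[of _ "e 0"] op_pow_contraction[OF Uc, of i] op_pow_contraction[OF U'c, of i]
      by fastforce+
    have W_le: "norm (op_pow (W l) i (F v)) \<le> nrm (op_pow (W l) i o\<^sub>L F o\<^sub>L op_pow U i)"
      if "F \<in> B" "l \<in> {1..N}" "norm v \<le> 1" for l i F v
    proof -
      have "norm (op_pow ?U' i v) \<le> 1"
        using norm_blinfun_contract[of "op_pow ?U' i" v] op_pow_contraction[OF U'c, of i] that(3) by simp
      from app_le[OF WFU_B[OF that(1,2), of i] this] show ?thesis by (simp add: UU')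
    qed
    have squeeze: "(\<lambda>k. norm (f k)) \<longlonglongrightarrow> 0"
      if "\<And>k. norm (f k) \<le> g k" "g \<longlonglongrightarrow> 0" for f :: "nat \<Rightarrow> 'a" and g
      by (rule tendsto_sandwich[OF _ _ tendsto_const that(2)]) (use that(1) in auto)
    show ?crit_H
      unfolding d_hypercyclicity_criterion_def pow_H
    proof (intro conjI exI[of _ n] exI[of _ E] exI[of _ V'] ballI allI impI)
      show "strict_mono n" by (rule n)
      show "dense_in UNIV norm (E l)" if l: "l \<in> {0..N}" for l
        unfolding dense_in_def
      proof (intro conjI ballI allI impI)
        fix x :: 'a and \<epsilon> :: real assume "\<epsilon> > 0"
        then obtain F where F: "F \<in> D l" "nrm (rank_one x (e 0) - F) < \<epsilon>"
          using D[OF l] ideal_rank_one unfolding dense_in_def by blast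
        have "(rank_one x (e 0) - F) (e 0) = x - F (e 0)"
          by (simp add: blinfun.diff_left rank_one_apply cinner_basis)
        then have "norm (x - F (e 0)) < \<epsilon>"
          using app_le[of "rank_one x (e 0) - F" "e 0"] ideal_diff[OF ideal_rank_one DB[OF F(1) l], of x "e 0"] F(2)
          by simp
        then show "\<exists>d\<in>E l. norm (x - d) < \<epsilon>" using F(1) by (auto simp: E_def)
      qed simp
      show "(\<lambda>k. norm (op_pow (W l) (r l * n k) x)) \<longlonglongrightarrow> 0"
        if l: "l \<in> {1..N}" and x: "x \<in> E 0" for l x
      proof (rule squeeze[OF _ D0[OF l \<Phi>_in[OF x]]])
        show "norm (op_pow (W l) (r l * n k) x)
            \<le> nrm (op_pow (W l) (r l * n k) o\<^sub>L \<Phi> 0 x o\<^sub>L op_pow U (r l * n k))" for k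
          using W_le[OF DB[OF \<Phi>_in[OF x]] l, of "e 0" "r l * n k"] \<Phi>_eq[OF x] by simp
      qed
      show "(\<lambda>k. norm (V' l k x)) \<longlonglongrightarrow> 0" if l: "l \<in> {1..N}" and x: "x \<in> E l" for l x
        unfolding V'_def
        by (rule squeeze[OF _ V[OF l \<Phi>_in[OF x]]]) (intro app_le VinB x l pU_le)
      show "(\<lambda>k. norm (op_pow (W l) (r l * n k) (V' s k x))) \<longlonglongrightarrow> 0"
        if l: "l \<in> {1..N}" and s: "s \<in> {1..N}" "s \<noteq> l" and x: "x \<in> E s" for l s x
        unfolding V'_def
        by (rule squeeze[OF _ VW[OF l s \<Phi>_in[OF x]]]) (intro W_le VinB x l s pU_le)
      show "(\<lambda>k. norm (op_pow (W l) (r l * n k) (V' l k x) - x)) \<longlonglongrightarrow> 0"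
        if l: "l \<in> {1..N}" and x: "x \<in> E l" for l x
      proof (rule squeeze[OF _ Vid[OF l \<Phi>_in[OF x]]])
        fix k
        let ?G = "(op_pow (W l) (r l * n k) o\<^sub>L V l k (\<Phi> l x) o\<^sub>L op_pow U (r l * n k)) - \<Phi> l x"
        have "?G \<in> B"
          using WFU_B[OF VinB[OF x l] l] DB[OF \<Phi>_in[OF x]] l by (intro ideal_diff) auto
        moreover have "op_pow (W l) (r l * n k) (V' l k x) - x = ?G (e 0)"
          by (simp add: V'_def blinfun.diff_left \<Phi>_eq[OF x])
        ultimately show "norm (op_pow (W l) (r l * n k) (V' l k x) - x) \<le> nrm ?G"
          using app_le[of ?G "e 0"] by simp
      qed
    qed auto
  }
qed

end

section \<open>Compact operators\<close>

context hilbert_basis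
begin

lemma norm_blinfun_le_unit_ball:
  fixes T :: "'a \<Rightarrow>\<^sub>L 'a"
  assumes "\<And>x. norm x \<le> 1 \<Longrightarrow> norm (T x) \<le> c" and "0 \<le> c"
  shows "norm T \<le> c"
proof (rule norm_blinfun_bound[OF assms(2)])
  fix x
  show "norm (T x) \<le> c * norm x"
  proof (cases "x = 0")
    case False
    then have "norm (T (x /\<^sub>R norm x)) \<le> c" by (intro assms(1)) simp
    then show ?thesis using False by (simp add: blinfun.scaleR_right field_simps)
  qed (simp add: blinfun.zero_right)
qed

lemma compact_opsI:
  assumes "T \<in> bounded_ops" "compact K" "T ` cball 0 1 \<subseteq> K"
  shows "T \<in> compact_ops"
proof -
  have "closure (T ` cball 0 1) \<subseteq> K"
    using assms by (simp add: closure_minimal compact_imp_closed)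
  then have "compact (closure (T ` cball 0 1))"
    using compact_Int_closed[OF assms(2) closed_closure[of "T ` cball 0 1"]] by (simp add: Int_absorb1)
  then show ?thesis using assms(1) by (simp add: compact_ops_def)
qed

text \<open>The projections converge to the identity uniformly on compact sets.\<close>

lemma compact_approx:
  assumes K: "compact K" and \<epsilon>: "\<epsilon> > 0"
  shows "\<exists>k. \<forall>z\<in>K. norm (z - proj k z) \<le> \<epsilon>"
proof -
  obtain C where C: "finite C" "K \<subseteq> (\<Union>c\<in>C. ball c (\<epsilon> / 3))"
    using K \<epsilon> unfolding compact_eq_totally_bounded by (meson divide_pos_pos zero_less_numeral)
  have "\<forall>c\<in>C. \<forall>\<^sub>F k in sequentially. dist (proj k c) c < \<epsilon> / 3"
    using \<epsilon> by (intro ballI tendstoD[OF proj_tendsto]) simp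
  then have "\<forall>\<^sub>F k in sequentially. \<forall>c\<in>C. dist (proj k c) c < \<epsilon> / 3"
    by (simp add: eventually_ball_finite_distrib C(1))
  then obtain k where k: "\<And>c. c \<in> C \<Longrightarrow> dist (proj k c) c < \<epsilon> / 3"
    by (auto simp: eventually_sequentially)
  have "norm (z - proj k z) \<le> \<epsilon>" if z: "z \<in> K" for z
  proof -
    obtain c where c: "c \<in> C" "dist c z < \<epsilon> / 3" using subsetD[OF C(2) z] by auto
    have split: "z - proj k z = (z - c) + ((c - proj k c) + proj k (c - z))"
      by (simp add: blinfun.diff_right)
    have "norm (z - proj k z) \<le> norm (z - c) + (norm (c - proj k c) + norm (proj k (c - z)))"
      unfolding split by (intro order_trans[OF norm_triangle_ineq] add_left_mono norm_triangle_ineq)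
    then show ?thesis using k[OF c(1)] c(2) norm_proj_apply_le[of k "c - z"]
      by (simp add: dist_norm norm_minus_commute)
  qed
  then show ?thesis by blast
qed

text \<open>
  A compact \<open>F\<close> is close to the finite-rank operator \<open>P\<^sub>k F\<close>, for which right multiplication by
  \<open>P\<^sub>m\<close> converges in norm.
\<close>

lemma compact_op_approx:
  assumes F: "F \<in> compact_ops" and \<epsilon>: "\<epsilon> > 0"
  shows "\<exists>m. \<exists>A\<in>bounded_ops. norm (F - (A o\<^sub>L proj m)) < \<epsilon>"
proof -
  have Fb: "F \<in> bounded_ops" and K: "compact (closure (F ` cball 0 1))"
    using F by (auto simp: compact_ops_def)
  obtain k where k: "\<And>z. z \<in> closure (F ` cball 0 1) \<Longrightarrow> norm (z - proj k z) \<le> \<epsilon> / 3"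
    using compact_approx[OF K, of "\<epsilon> / 3"] \<epsilon> by auto
  define A where "A = proj k o\<^sub>L F"
  have Ab: "A \<in> bounded_ops" using Fb by (auto simp: A_def)
  have FA: "norm (F - A) \<le> \<epsilon> / 3"
  proof (rule norm_blinfun_le_unit_ball)
    fix x :: 'a assume "norm x \<le> 1"
    then have "F x \<in> closure (F ` cball 0 1)"
      by (intro subsetD[OF closure_subset] imageI) simp
    then show "norm ((F - A) x) \<le> \<epsilon> / 3" using k by (simp add: A_def blinfun.diff_left)
  qed (use \<epsilon> in simp)
  define g where "g i = adjoint_op F (e i)" for i
  have A_eq: "A = (\<Sum>i<k. rank_one (e i) (g i))"
    by (rule blinfun_eqI) (simp add: A_def g_def proj_apply blinfun.sum_left rank_one_apply cinner_adjoint[OF Fb])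
  have AP: "A - (A o\<^sub>L proj m) = (\<Sum>i<k. rank_one (e i) (g i - proj m (g i)))" for m
    unfolding A_eq
    by (rule blinfun_eqI)
       (simp add: blinfun.sum_left blinfun.diff_left rank_one_apply proj_symmetric cinner_diff_right
         sum_subtractf[symmetric] bounded_bilinear.diff_left[OF bounded_bilinear_scaleC])
  have "(\<lambda>m. \<Sum>i<k. norm (g i - proj m (g i))) \<longlonglongrightarrow> (\<Sum>i<k. norm (g i - g i))"
    by (intro tendsto_intros proj_tendsto)
  then have "\<forall>\<^sub>F m in sequentially. (\<Sum>i<k. norm (g i - proj m (g i))) < \<epsilon> / 3"
    using \<epsilon> by (intro order_tendstoD(2)) auto
  then obtain m where m: "(\<Sum>i<k. norm (g i - proj m (g i))) < \<epsilon> / 3"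
    by (auto simp: eventually_sequentially)
  have "norm (A - (A o\<^sub>L proj m)) \<le> (\<Sum>i<k. norm (rank_one (e i) (g i - proj m (g i))))"
    unfolding AP by (rule norm_sum)
  also have "\<dots> \<le> (\<Sum>i<k. norm (g i - proj m (g i)))"
    using norm_rank_one_le[of "e _"] by (intro sum_mono) simp
  finally have "norm (A - (A o\<^sub>L proj m)) < \<epsilon> / 3" using m by simp
  then have "norm (F - (A o\<^sub>L proj m)) < \<epsilon>"
    using norm_triangle_ineq[of "F - A" "A - (A o\<^sub>L proj m)"] FA \<epsilon> by simp
  then show ?thesis using Ab by blast
qed

lemma operator_ideal_compact: "operator_ideal e compact_ops norm"
proof unfold_locales
  fix F G :: "'a \<Rightarrow>\<^sub>L 'a"
  assume F: "F \<in> compact_ops" and G: "G \<in> compact_ops"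
  let ?K = "{x + y | x y. x \<in> closure (F ` cball 0 1) \<and> y \<in> closure (G ` cball 0 1)}"
  have "compact ?K" using F G by (intro compact_sums) (auto simp: compact_ops_def)
  moreover have "(F + G) ` cball 0 1 \<subseteq> ?K"
  proof
    fix z assume "z \<in> (F + G) ` cball 0 1"
    then obtain x where "x \<in> cball 0 1" "z = F x + G x" by (auto simp: blinfun.add_left)
    then show "z \<in> ?K" using closure_subset by blast
  qed
  ultimately show "F + G \<in> compact_ops"
    using F G by (intro compact_opsI) (auto simp: compact_ops_def)
next
  fix F W U :: "'a \<Rightarrow>\<^sub>L 'a"
  assume F: "F \<in> compact_ops" and W: "W \<in> bounded_ops" and U: "unitary_op U"
  show "W o\<^sub>L F o\<^sub>L U \<in> compact_ops"
  proof (rule compact_opsI)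
    show "W o\<^sub>L F o\<^sub>L U \<in> bounded_ops"
      using F W U by (auto simp: compact_ops_def unitary_op_def)
    show "compact (W ` closure (F ` cball 0 1))"
      using F by (intro compact_continuous_image continuous_intros) (auto simp: compact_ops_def)
    show "(W o\<^sub>L F o\<^sub>L U) ` cball 0 1 \<subseteq> W ` closure (F ` cball 0 1)"
    proof
      fix z assume "z \<in> (W o\<^sub>L F o\<^sub>L U) ` cball 0 1"
      then obtain x where x: "norm x \<le> 1" "z = W (F (U x))" by auto
      then have "F (U x) \<in> F ` cball 0 1" by (intro imageI) (simp add: unitary_norm[OF U])
      then show "z \<in> W ` closure (F ` cball 0 1)" using x(2) closure_subset by blast
    qed
  qed
next
  fix x y :: 'a
  show "rank_one x y \<in> compact_ops"
  proof (rule compact_opsI)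
    show "compact ((\<lambda>c. c *\<^sub>C x) ` cball 0 (norm y))"
      by (intro compact_continuous_image compact_cball linear_continuous_on
          bounded_bilinear.bounded_linear_left[OF bounded_bilinear_scaleC])
    show "rank_one x y ` cball 0 1 \<subseteq> (\<lambda>c. c *\<^sub>C x) ` cball 0 (norm y)"
    proof
      fix z assume "z \<in> rank_one x y ` cball 0 1"
      then obtain u where u: "norm u \<le> 1" "z = cinner u y *\<^sub>C x" by (auto simp: rank_one_apply)
      have "cmod (cinner u y) \<le> norm y"
        using norm_cinner_le[of u y] mult_right_mono[OF u(1), of "norm y"] by simp
      then show "z \<in> (\<lambda>c. c *\<^sub>C x) ` cball 0 (norm y)" using u(2) by auto
    qed
  qed simp
qed (use norm_triangle_ineq norm_rank_one_le compact_op_approx in auto)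

lemma square_sum_tail:
  fixes A :: "'a \<Rightarrow>\<^sub>L 'a"
  assumes sm: "summable (\<lambda>j. (norm (A (e j)))\<^sup>2)" and \<delta>: "\<delta> > 0"
  shows "\<exists>m. summable (\<lambda>j. (norm (A ((id_blinfun - proj m) (e j))))\<^sup>2) \<and>
    (\<Sum>j. (norm (A ((id_blinfun - proj m) (e j))))\<^sup>2) < \<delta>"
proof -
  let ?a = "\<lambda>j. (norm (A (e j)))\<^sup>2"
  obtain m where m: "norm (\<Sum>i. ?a (i + m)) < \<delta>"
    using suminf_exist_split[OF \<delta> sm] by auto
  have eq: "(norm (A ((id_blinfun - proj m) (e j))))\<^sup>2 = (if j < m then 0 else ?a j)" for j
    by (simp add: blinfun.diff_left proj_basis blinfun.zero_right)
  have "(\<lambda>i. ?a (i + m)) sums (\<Sum>i. ?a (i + m))"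
    by (intro summable_sums summable_ignore_initial_segment sm)
  then have "(\<lambda>j. if j < m then 0 else ?a j) sums (\<Sum>i. ?a (i + m))"
    using sums_iff_shift'[of "\<lambda>j. if j < m then 0 else ?a j" m "\<Sum>i. ?a (i + m)"] by simp
  then show ?thesis
    using m by (intro exI[of _ m], unfold eq) (auto simp: sums_iff)
qed

section \<open>Hilbert--Schmidt operators\<close>

lemma hilbert_schmidtI:
  fixes T :: "'a \<Rightarrow>\<^sub>L 'a"
  assumes T: "T \<in> bounded_ops" and C: "0 \<le> C"
    and le: "\<And>n. (\<Sum>j<n. (norm (T (e j)))\<^sup>2) \<le> C\<^sup>2"
  shows "T \<in> hilbert_schmidt_ops e" and "hilbert_schmidt_norm e T \<le> C"
proof -
  have sm: "summable (\<lambda>j. (norm (T (e j)))\<^sup>2)"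
    using le by (intro summableI_nonneg_bounded) auto
  then show "T \<in> hilbert_schmidt_ops e" using T by (simp add: hilbert_schmidt_ops_def)
  have "(\<Sum>j. (norm (T (e j)))\<^sup>2) \<le> C\<^sup>2" by (rule suminf_le_const[OF sm le])
  then show "hilbert_schmidt_norm e T \<le> C"
    using C by (simp add: hilbert_schmidt_norm_def real_le_lsqrt suminf_nonneg[OF sm])
qed

lemma
  fixes T :: "'a \<Rightarrow>\<^sub>L 'a"
  assumes "T \<in> hilbert_schmidt_ops e"
  shows hilbert_schmidt_bounded: "T \<in> bounded_ops"
    and hilbert_schmidt_summable: "summable (\<lambda>j. (norm (T (e j)))\<^sup>2)"
    and hilbert_schmidt_norm_sq: "(hilbert_schmidt_norm e T)\<^sup>2 = (\<Sum>j. (norm (T (e j)))\<^sup>2)"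
    and hilbert_schmidt_norm_nonneg: "0 \<le> hilbert_schmidt_norm e T"
    and hilbert_schmidt_sum_le: "(\<Sum>j<n. (norm (T (e j)))\<^sup>2) \<le> (hilbert_schmidt_norm e T)\<^sup>2"
proof -
  show b: "T \<in> bounded_ops" and sm: "summable (\<lambda>j. (norm (T (e j)))\<^sup>2)"
    using assms by (auto simp: hilbert_schmidt_ops_def)
  have "0 \<le> (\<Sum>j. (norm (T (e j)))\<^sup>2)" by (rule suminf_nonneg[OF sm]) simp
  then show sq: "(hilbert_schmidt_norm e T)\<^sup>2 = (\<Sum>j. (norm (T (e j)))\<^sup>2)"
    and "0 \<le> hilbert_schmidt_norm e T"
    by (simp_all add: hilbert_schmidt_norm_def)
  show "(\<Sum>j<n. (norm (T (e j)))\<^sup>2) \<le> (hilbert_schmidt_norm e T)\<^sup>2"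
    unfolding sq by (rule sum_le_suminf[OF sm]) auto
qed

lemma norm_le_hilbert_schmidt_norm:
  assumes T: "T \<in> hilbert_schmidt_ops e"
  shows "norm T \<le> hilbert_schmidt_norm e T"
proof -
  note Tb = hilbert_schmidt_bounded[OF T] and nn = hilbert_schmidt_norm_nonneg[OF T]
  have "norm (adjoint_op T) \<le> hilbert_schmidt_norm e T"
  proof (rule norm_blinfun_bound[OF nn])
    fix y
    have "(norm (proj n (adjoint_op T y)))\<^sup>2 \<le> (hilbert_schmidt_norm e T * norm y)\<^sup>2" for n
    proof -
      have "cmod (cinner (adjoint_op T y) (e j)) \<le> norm y * norm (T (e j))" for j
        by (simp add: cinner_adjoint'[OF Tb] norm_cinner_le)
      then have "(norm (proj n (adjoint_op T y)))\<^sup>2 \<le> (\<Sum>j<n. (norm y * norm (T (e j)))\<^sup>2)"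
        unfolding norm_proj_sq by (intro sum_mono power_mono) auto
      also have "\<dots> = (norm y)\<^sup>2 * (\<Sum>j<n. (norm (T (e j)))\<^sup>2)"
        by (simp add: power_mult_distrib sum_distrib_left)
      also have "\<dots> \<le> (norm y)\<^sup>2 * (hilbert_schmidt_norm e T)\<^sup>2"
        by (intro mult_left_mono hilbert_schmidt_sum_le T) simp
      finally show ?thesis by (simp add: power_mult_distrib mult.commute)
    qed
    then have "norm (proj n (adjoint_op T y)) \<le> hilbert_schmidt_norm e T * norm y" for n
      by (rule power2_le_imp_le) (simp add: nn)
    then show "norm (adjoint_op T y) \<le> hilbert_schmidt_norm e T * norm y"
      using LIMSEQ_le_const2[OF tendsto_norm[OF proj_tendsto[of "adjoint_op T y"]]] by blast
  qed
  then show ?thesis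
    using norm_adjoint_le[of "adjoint_op T"] Tb by (simp add: adjoint_adjoint)
qed

lemma operator_ideal_hilbert_schmidt:
  "operator_ideal e (hilbert_schmidt_ops e) (hilbert_schmidt_norm e)"
proof unfold_locales
  fix F G assume F: "F \<in> hilbert_schmidt_ops e" and G: "G \<in> hilbert_schmidt_ops e"
  let ?C = "hilbert_schmidt_norm e F + hilbert_schmidt_norm e G"
  have L2: "L2_set (\<lambda>j. norm (T (e j))) {..<n} \<le> hilbert_schmidt_norm e T"
    if "T \<in> hilbert_schmidt_ops e" for T n
    unfolding L2_set_def
    using hilbert_schmidt_sum_le[OF that, of n] hilbert_schmidt_norm_nonneg[OF that]
    by (simp add: real_le_lsqrt sum_nonneg)
  have "(\<Sum>j<n. (norm ((F + G) (e j)))\<^sup>2) \<le> ?C\<^sup>2" for n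
  proof -
    have "L2_set (\<lambda>j. norm ((F + G) (e j))) {..<n} \<le> L2_set (\<lambda>j. norm (F (e j)) + norm (G (e j))) {..<n}"
      by (intro L2_set_mono) (simp_all add: blinfun.add_left norm_triangle_ineq)
    also have "\<dots> \<le> ?C"
      using L2_set_triangle_ineq[of "\<lambda>j. norm (F (e j))" "\<lambda>j. norm (G (e j))" "{..<n}"] L2[OF F, of n] L2[OF G, of n]
      by simp
    finally have "(L2_set (\<lambda>j. norm ((F + G) (e j))) {..<n})\<^sup>2 \<le> ?C\<^sup>2"
      by (intro power_mono L2_set_nonneg)
    then show ?thesis by (simp add: L2_set_def sum_nonneg)
  qed
  from hilbert_schmidtI[OF _ _ this] show "F + G \<in> hilbert_schmidt_ops e"
    and "hilbert_schmidt_norm e (F + G) \<le> ?C"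
    using hilbert_schmidt_bounded[OF F] hilbert_schmidt_bounded[OF G]
      hilbert_schmidt_norm_nonneg[OF F] hilbert_schmidt_norm_nonneg[OF G] by auto
next
  fix F W U :: "'a \<Rightarrow>\<^sub>L 'a"
  assume F: "F \<in> hilbert_schmidt_ops e" and W: "W \<in> bounded_ops" and U: "unitary_op U"
  note Fb = hilbert_schmidt_bounded[OF F]
  show "W o\<^sub>L F o\<^sub>L U \<in> hilbert_schmidt_ops e"
  proof (rule hilbert_schmidtI)
    show "W o\<^sub>L F o\<^sub>L U \<in> bounded_ops" using Fb W U by (auto simp: unitary_op_def)
    show "0 \<le> norm W * hilbert_schmidt_norm e F" using hilbert_schmidt_norm_nonneg[OF F] by simp
    fix n
    have "(\<Sum>j<n. (norm ((W o\<^sub>L F o\<^sub>L U) (e j)))\<^sup>2) \<le> (\<Sum>j<n. (norm W)\<^sup>2 * (norm (F (U (e j))))\<^sup>2)"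
      using power_mono[OF norm_blinfun[of W], of _ 2] by (intro sum_mono) (simp add: power_mult_distrib)
    also have "\<dots> = (norm W)\<^sup>2 * (\<Sum>j<n. (norm (F (U (e j))))\<^sup>2)" by (simp add: sum_distrib_left)
    also have "\<dots> \<le> (norm W)\<^sup>2 * (hilbert_schmidt_norm e F)\<^sup>2"
      using sum_compose_contraction_le[OF Fb hilbert_schmidt_summable[OF F] unitary_contraction[OF U], of n]
      by (intro mult_left_mono) (simp_all add: hilbert_schmidt_norm_sq[OF F])
    finally show "(\<Sum>j<n. (norm ((W o\<^sub>L F o\<^sub>L U) (e j)))\<^sup>2) \<le> (norm W * hilbert_schmidt_norm e F)\<^sup>2"
      by (simp add: power_mult_distrib)
  qed
next
  fix x y :: 'a
  have "(\<Sum>j<n. (norm (rank_one x y (e j)))\<^sup>2) \<le> (norm x * norm y)\<^sup>2" for n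
  proof -
    have "cmod (cinner (e j) y) = cmod (cinner y (e j))" for j
      by (metis cinner_commute complex_mod_cnj)
    then have "(\<Sum>j<n. (norm (rank_one x y (e j)))\<^sup>2) = (norm x)\<^sup>2 * (\<Sum>j<n. (cmod (cinner y (e j)))\<^sup>2)"
      by (simp add: rank_one_apply norm_scaleC power_mult_distrib sum_distrib_left mult.commute)
    then show ?thesis using mult_left_mono[OF Bessel[of y n], of "(norm x)\<^sup>2"]
      by (simp add: power_mult_distrib)
  qed
  from hilbert_schmidtI[OF _ _ this]
  show "rank_one x y \<in> hilbert_schmidt_ops e" "hilbert_schmidt_norm e (rank_one x y) \<le> norm x * norm y"
    by auto
next
  fix F and \<epsilon> :: real assume F: "F \<in> hilbert_schmidt_ops e" and \<epsilon>: "\<epsilon> > 0"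
  note Fb = hilbert_schmidt_bounded[OF F] and sm = hilbert_schmidt_summable[OF F]
  obtain m where m: "summable (\<lambda>j. (norm (F ((id_blinfun - proj m) (e j))))\<^sup>2)"
      "(\<Sum>j. (norm (F ((id_blinfun - proj m) (e j))))\<^sup>2) < (\<epsilon> / 2)\<^sup>2"
    using square_sum_tail[OF sm, of "(\<epsilon> / 2)\<^sup>2"] \<epsilon> by auto
  have "hilbert_schmidt_norm e (F - (F o\<^sub>L proj m)) \<le> \<epsilon> / 2"
  proof (rule hilbert_schmidtI(2))
    show "F - (F o\<^sub>L proj m) \<in> bounded_ops" using Fb by auto
    fix n
    have "(\<Sum>j<n. (norm ((F - (F o\<^sub>L proj m)) (e j)))\<^sup>2)
        = (\<Sum>j<n. (norm (F ((id_blinfun - proj m) (e j))))\<^sup>2)"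
      by (simp add: blinfun.diff_left blinfun.diff_right)
    also have "\<dots> \<le> (\<Sum>j. (norm (F ((id_blinfun - proj m) (e j))))\<^sup>2)"
      by (intro sum_le_suminf m(1)) auto
    also have "\<dots> \<le> (\<epsilon> / 2)\<^sup>2" using m(2) by simp
    finally show "(\<Sum>j<n. (norm ((F - (F o\<^sub>L proj m)) (e j)))\<^sup>2) \<le> (\<epsilon> / 2)\<^sup>2" .
  qed (use \<epsilon> in simp)
  then show "\<exists>m. \<exists>A\<in>bounded_ops. hilbert_schmidt_norm e (F - (A o\<^sub>L proj m)) < \<epsilon>"
    using Fb \<epsilon> by (intro exI[of _ m] bexI[of _ F]) auto
qed (rule norm_le_hilbert_schmidt_norm)

section \<open>Trace class operators\<close>

lemma trace_class_bounded: "T \<in> trace_class_ops e \<Longrightarrow> T \<in> bounded_ops"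
  by (simp add: trace_class_ops_def)

lemma trace_norm_ge':
  fixes T :: "'a \<Rightarrow>\<^sub>L 'a"
  assumes "T \<in> trace_class_ops e" "K \<in> contractions"
  shows "(\<Sum>j<n. Re (cinner (T (e j)) (K (e j)))) \<le> trace_norm e T"
  using trace_norm_ge[OF assms(1) id_contraction assms(2)] by simp

text \<open>Rank-one contractions with \<open>e 0 \<mapsto> x\<close> and \<open>e 0 \<mapsto> y\<close> test a single matrix entry.\<close>

lemma norm_le_trace_norm:
  assumes T: "T \<in> trace_class_ops e"
  shows "norm T \<le> trace_norm e T"
proof (rule norm_blinfun_le_unit_ball)
  show nn: "0 \<le> trace_norm e T"
    using trace_norm_ge'[OF T id_contraction, of 0] by simp
  fix x :: 'a assume x: "norm x \<le> 1"
  show "norm (T x) \<le> trace_norm e T"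
  proof (rule Re_cinner_le_imp_norm_le[OF _ nn])
    fix y :: 'a assume y: "norm y \<le> 1"
    have "rank_one z (e 0) \<in> contractions" if "norm z \<le> 1" for z
      using norm_rank_one_le[of z "e 0"] that by auto
    then show "Re (cinner (T x) y) \<le> trace_norm e T"
      using trace_norm_ge[OF T, of "rank_one x (e 0)" "rank_one y (e 0)" 1] x y
      by (simp add: rank_one_apply cinner_basis)
  qed
qed

lemma operator_ideal_trace_class: "operator_ideal e (trace_class_ops e) (trace_norm e)"
proof unfold_locales
  fix F G assume F: "F \<in> trace_class_ops e" and G: "G \<in> trace_class_ops e"
  have "(\<Sum>j<n. Re (cinner ((F + G) (e j)) (K (e j)))) \<le> trace_norm e F + trace_norm e G"
    if "K \<in> contractions" for K n
    using add_mono[OF trace_norm_ge'[OF F that] trace_norm_ge'[OF G that]]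
    by (simp add: blinfun.add_left cinner_add_left sum.distrib)
  from trace_normI[OF _ this] show "F + G \<in> trace_class_ops e"
    and "trace_norm e (F + G) \<le> trace_norm e F + trace_norm e G"
    using trace_class_bounded[OF F] trace_class_bounded[OF G] by auto
next
  fix F W U :: "'a \<Rightarrow>\<^sub>L 'a"
  assume F: "F \<in> trace_class_ops e" and W: "W \<in> bounded_ops" and U: "unitary_op U"
  note Fb = trace_class_bounded[OF F]
  \<comment> \<open>rescale \<open>W\<close> to a contraction; the summand \<open>1\<close> avoids division by zero\<close>
  define c where "c = 1 + norm W"
  have c: "c > 0" by (simp add: c_def add_pos_nonneg)
  define S where "S = (1 / c) *\<^sub>R W"
  have S: "S \<in> contractions"
    using W c by (auto simp: S_def c_def divide_simps)
  have WS: "W x = c *\<^sub>R S x" for x using c by (simp add: S_def blinfun.scaleR_left)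
  show "W o\<^sub>L F o\<^sub>L U \<in> trace_class_ops e"
  proof (rule trace_normI)
    show "W o\<^sub>L F o\<^sub>L U \<in> bounded_ops" using Fb W U by (auto simp: unitary_op_def)
    fix n K assume K: "K \<in> (contractions :: ('a \<Rightarrow>\<^sub>L 'a) set)"
    have "(\<Sum>j<n. Re (cinner ((W o\<^sub>L F o\<^sub>L U) (e j)) (K (e j))))
        = c * (\<Sum>j<n. Re (cinner (F (U (e j))) ((adjoint_op S o\<^sub>L K) (e j))))"
      using S by (simp add: WS cinner_scaleR_left cinner_adjoint sum_distrib_left)
    also have "\<dots> \<le> c * trace_norm e F"
      using c by (intro mult_left_mono trace_norm_ge F unitary_contraction U compose_contractions
          adjoint_contraction S K) simp
    finally show "(\<Sum>j<n. Re (cinner ((W o\<^sub>L F o\<^sub>L U) (e j)) (K (e j)))) \<le> c * trace_norm e F" .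
  qed
next
  fix x y :: 'a
  have "(\<Sum>j<n. Re (cinner (rank_one x y (e j)) (K (e j)))) \<le> norm x * norm y"
    if K: "K \<in> contractions" for K n
  proof -
    let ?z = "adjoint_op K x"
    have "Re (cinner (rank_one x y (e j)) (K (e j))) \<le> cmod (cinner y (e j)) * cmod (cinner ?z (e j))" for j
    proof -
      have "cmod (cinner (e j) y) = cmod (cinner y (e j))"
        by (metis cinner_commute complex_mod_cnj)
      then show ?thesis
        using complex_Re_le_cmod[of "cinner (rank_one x y (e j)) (K (e j))"] K
        by (simp add: rank_one_apply cinner_scaleC_left norm_mult cinner_adjoint')
    qed
    then have "(\<Sum>j<n. Re (cinner (rank_one x y (e j)) (K (e j))))
        \<le> (\<Sum>j<n. cmod (cinner y (e j)) * cmod (cinner ?z (e j)))"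
      by (rule sum_mono)
    also have "\<dots> \<le> L2_set (\<lambda>j. cmod (cinner y (e j))) {..<n} * L2_set (\<lambda>j. cmod (cinner ?z (e j))) {..<n}"
      using L2_set_mult_ineq[of "\<lambda>j. cmod (cinner y (e j))" "\<lambda>j. cmod (cinner ?z (e j))" "{..<n}"] by simp
    also have "\<dots> \<le> norm y * norm ?z"
      by (intro mult_mono L2_set_nonneg norm_ge_zero)
         (simp_all add: L2_set_def real_le_lsqrt sum_nonneg Bessel)
    also have "\<dots> \<le> norm y * norm x"
      using adjoint_contraction[OF K] by (intro mult_left_mono norm_blinfun_contract) auto
    finally show ?thesis by (simp add: mult.commute)
  qed
  from trace_normI[OF _ this]
  show "rank_one x y \<in> trace_class_ops e" "trace_norm e (rank_one x y) \<le> norm x * norm y"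
    by auto
next
  fix F and \<epsilon> :: real assume F: "F \<in> trace_class_ops e" and \<epsilon>: "\<epsilon> > 0"
  note Fb = trace_class_bounded[OF F]
  obtain Q :: "'a \<Rightarrow>\<^sub>L 'a" where Q: "(\<lambda>i. (norm (Q (e i)))\<^sup>2) sums trace_norm e F"
    and le: "\<forall>n M L K. M \<in> bounded_ops \<longrightarrow> summable (\<lambda>i. (norm (Q (M (e i))))\<^sup>2) \<longrightarrow>
      L \<in> contractions \<longrightarrow> K \<in> contractions \<longrightarrow>
      (\<Sum>j<n. Re (cinner (F (M (blinfun_apply L (e j)))) (blinfun_apply K (e j))))
        \<le> sqrt (\<Sum>i. (norm (Q (M (e i))))\<^sup>2) * sqrt (trace_norm e F)"
    using trace_class_factor[OF F] by blast
  define t where "t = trace_norm e F + 1"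
  have nn: "0 \<le> trace_norm e F"
    by (rule order_trans[OF norm_ge_zero norm_le_trace_norm[OF F]])
  then have t: "t > 0" "trace_norm e F \<le> t" by (simp_all add: t_def)
  have pos: "(\<epsilon> / 2)\<^sup>2 / t > 0" using \<epsilon> t by simp
  obtain m where m: "summable (\<lambda>j. (norm (Q ((id_blinfun - proj m) (e j))))\<^sup>2)"
      "(\<Sum>j. (norm (Q ((id_blinfun - proj m) (e j))))\<^sup>2) < (\<epsilon> / 2)\<^sup>2 / t"
    using square_sum_tail[OF sums_summable[OF Q] pos] by blast
  have "trace_norm e (F - (F o\<^sub>L proj m)) \<le> \<epsilon> / 2"
  proof (rule trace_normI(2))
    show "F - (F o\<^sub>L proj m) \<in> bounded_ops" using Fb by auto
    fix n K assume K: "K \<in> (contractions :: ('a \<Rightarrow>\<^sub>L 'a) set)"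
    have "(\<Sum>j<n. Re (cinner ((F - (F o\<^sub>L proj m)) (e j)) (K (e j))))
        \<le> sqrt (\<Sum>j. (norm (Q ((id_blinfun - proj m) (e j))))\<^sup>2) * sqrt (trace_norm e F)"
      using le[rule_format, of "id_blinfun - proj m" id_blinfun K n] m(1) K id_contraction
      by (simp add: blinfun.diff_left blinfun.diff_right bounded_ops_diff)
    also have "\<dots> \<le> sqrt ((\<epsilon> / 2)\<^sup>2 / t) * sqrt t"
      using m(2) t nn pos by (intro mult_mono real_sqrt_le_mono) simp_all
    also have "\<dots> = \<epsilon> / 2" using \<epsilon> t by (simp add: real_sqrt_divide)
    finally show "(\<Sum>j<n. Re (cinner ((F - (F o\<^sub>L proj m)) (e j)) (K (e j)))) \<le> \<epsilon> / 2" .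
  qed
  then show "\<exists>m. \<exists>A\<in>bounded_ops. trace_norm e (F - (A o\<^sub>L proj m)) < \<epsilon>"
    using Fb \<epsilon> by (intro exI[of _ m] bexI[of _ F]) auto
qed (rule norm_le_trace_norm)

end

section \<open>The equivalence\<close>

theorem theorem2p14:
  fixes e :: "nat \<Rightarrow> 'a::complex_hilbert"
    and N :: nat
    and W :: "nat \<Rightarrow> ('a \<Rightarrow>\<^sub>L 'a)"
    and r :: "nat \<Rightarrow> nat"
    and B :: "('a \<Rightarrow>\<^sub>L 'a) set"
    and nrm :: "('a \<Rightarrow>\<^sub>L 'a) \<Rightarrow> real"
  assumes "orthonormal_basis e"
    and "N \<ge> 2"
    and "\<forall>l\<in>{1..N}. invertible_op (W l)"
    and "0 < r 1" and "strict_mono_on {1..N} r"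
    and "(B, nrm) \<in> {(compact_ops, norm), (trace_class_ops e, trace_norm e),
                      (hilbert_schmidt_ops e, hilbert_schmidt_norm e)}"
  shows "(\<forall>U. unitary_op U \<and>
            (\<forall>k. \<exists>N\<^sub>k. \<forall>n\<ge>N\<^sub>k. \<forall>x\<in>initial_span e k. \<forall>y\<in>initial_span e k.
               cinner ((blinfun_apply U ^^ n) x) y = 0) \<longrightarrow>
            (d_hypercyclicity_criterion B nrm N (\<lambda>l. mult_op U (W l) ^^ r l) \<longleftrightarrow>
             d_hypercyclicity_criterion UNIV norm N (\<lambda>l. blinfun_apply (W l) ^^ r l))) \<and>
         (d_hypercyclicity_criterion UNIV norm N (\<lambda>l. blinfun_apply (W l) ^^ r l) \<longleftrightarrow>
            (\<forall>U. unitary_op U \<longrightarrow>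
              d_hypercyclicity_criterion B nrm N (\<lambda>l. mult_op U (W l) ^^ r l)))"
proof -
  have "operator_ideal e B nrm"
  proof -
    interpret hilbert_basis e by unfold_locales (rule assms(1))
    show ?thesis
      using assms(6) operator_ideal_compact operator_ideal_trace_class operator_ideal_hilbert_schmidt
      by auto
  qed
  then interpret operator_ideal e B nrm .
  have W: "\<forall>l\<in>{1..N}. W l \<in> bounded_ops"
    using assms(3) by (simp add: invertible_op_def)
  note iff = criterion_operators_iff[OF _ W, of _ r]
  show ?thesis using unitary_id by (auto simp: iff)
qed

end
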